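(* Let $G$ be a virtually abelian group, let $H\leq G$ be any subgroup, let $S$ be any finite generating set of $G$, and let $\omega\colon S\to\{1,2,3,\ldots\}$ be any weight function. Then the weighted growth series of $H$ relative to $G$, $$\mathcal{S}^{\omega}_{H\leq G,S}(z)=\sum_{n=0}^{\infty}\#\{h\in H\mid \omega(h)=n\}\,z^n,$$ is a rational function.
   Context: A finite generating set $S$ of $G$ means a finite subset $S\subseteq G$ generating $G$ as a monoid; $S^*$ is the set of all finite words over $S$ (including the empty word). The weight of a word is $\omega(s_1s_2\cdots s_k)=\sum_{i=1}^k\omega(s_i)$, and the weight $\omega(g)$ of an element $g\in G$ is the minimal weight amongst all words in $S^*$ that represent $g$. In particular the weight of an element of $H$ is measured with respect to the generators $S$ of $G$. A formal power series is a rational function if it equals $p(z)/q(z)$ for some polynomials $p,q$ with integer coefficients. *)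

theory Defs
  imports
    "HOL-Algebra.Coset"
    "HOL-Computational_Algebra.Polynomial_FPS"
    "HOL-Computational_Algebra.Formal_Laurent_Series"
begin

(* Finite index is stated as finiteness of the set of cosets, not through its
   cardinality, because card is 0 on infinite sets. *)
definition virtually_abelian :: "('a, 'b) monoid_scheme \<Rightarrow> bool" where
  "virtually_abelian G \<longleftrightarrow>
     group G \<and>
     (\<exists>A. subgroup A G \<and> comm_group (G\<lparr>carrier := A\<rparr>) \<and> finite (rcosets\<^bsub>G\<^esub> A))"

definition word_eval :: "('a, 'b) monoid_scheme \<Rightarrow> 'a list \<Rightarrow> 'a" where
  "word_eval G w = foldr (\<otimes>\<^bsub>G\<^esub>) w \<one>\<^bsub>G\<^esub>"

(* Generation as a monoid: words use the letters of S but not their inverses. *)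
definition finite_generating_set :: "('a, 'b) monoid_scheme \<Rightarrow> 'a set \<Rightarrow> bool" where
  "finite_generating_set G S \<longleftrightarrow>
     finite S \<and> S \<subseteq> carrier G \<and> word_eval G ` lists S = carrier G"

definition word_weight :: "('a \<Rightarrow> nat) \<Rightarrow> 'a list \<Rightarrow> nat" where
  "word_weight \<omega> w = sum_list (map \<omega> w)"

(* The minimum is over a nonempty set whenever g is in carrier G and S generates G. *)
definition elem_weight ::
  "('a, 'b) monoid_scheme \<Rightarrow> 'a set \<Rightarrow> ('a \<Rightarrow> nat) \<Rightarrow> 'a \<Rightarrow> nat" where
  "elem_weight G S \<omega> g =
     (LEAST n. \<exists>w\<in>lists S. word_eval G w = g \<and> word_weight \<omega> w = n)"

(* The sets counted here are finite when S is a finite generating set, H is contained in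
   carrier G and all weights are positive, as there are then only finitely many words of
   each weight. *)
definition relative_growth_series ::
  "('a, 'b) monoid_scheme \<Rightarrow> 'a set \<Rightarrow> 'a set \<Rightarrow> ('a \<Rightarrow> nat) \<Rightarrow> rat fps" where
  "relative_growth_series G H S \<omega> =
     Abs_fps (\<lambda>n. of_nat (card {h \<in> H. elem_weight G S \<omega> h = n}))"

(* The quotient p/q is taken in the field of formal Laurent series: division on rat fps
   is a truncated one when p is not a multiple of q. *)
definition is_rational_function :: "rat fps \<Rightarrow> bool" where
  "is_rational_function F \<longleftrightarrow>
     (\<exists>p q :: int poly. q \<noteq> 0 \<and>
        fps_to_fls F = fps_to_fls (fps_of_poly (map_poly of_int p)) /
                       fps_to_fls (fps_of_poly (map_poly of_int q)))"

end

theory Submission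
  imports Defs "HOL-Algebra.FiniteProduct" "HOL-Library.Multiset_Order"
begin

text \<open>Let A be an abelian subgroup of finite index. A word over S is a walk in the finite
  graph of right cosets of A, and moving coset representatives through the word writes its value
  as a product of one element of A per edge, times the representative of the last coset. As A is
  abelian, value and weight depend only on the multiset of edges used. The edge multisets of the
  walks that visit exactly a given set V of cosets are closed under adding circulations supported
  in V, and comparable ones differ by such a circulation, so by Dickson's lemma they form finitely
  many translates of a finitely generated monoid. Images of such sets are closed under
  intersection (Dickson again), which handles both the overlaps for different V, by inclusion-
  exclusion, and the condition of lying in H. Finally, the generating function of such an image is
  rational, since choosing the least representing multiset of each element leaves the complement
  of an upward closed set of multisets. To count elements by minimal weight, one adds a trivial
  letter of weight 1: pairs of an element and the weight of some word for it then give the growth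
  series divided by 1 - z.\<close>

section \<open>Rational power series\<close>

lemma map_poly_of_int_add:
  "map_poly of_int (p + q) = (map_poly of_int p + map_poly of_int q :: rat poly)"
  by (rule poly_eqI) (simp add: coeff_map_poly)

lemma map_poly_of_int_diff:
  "map_poly of_int (p - q) = (map_poly of_int p - map_poly of_int q :: rat poly)"
  by (rule poly_eqI) (simp add: coeff_map_poly)

lemma map_poly_of_int_mult:
  "map_poly of_int (p * q) = (map_poly of_int p * map_poly of_int q :: rat poly)"
  by (rule poly_eqI) (simp add: coeff_map_poly coeff_mult)

definition fps_of_int_poly :: "int poly \<Rightarrow> rat fps" where
  "fps_of_int_poly p = fps_of_poly (map_poly of_int p)"

lemma fps_of_int_poly_simps:
  "fps_of_int_poly (p + q) = fps_of_int_poly p + fps_of_int_poly q"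
  "fps_of_int_poly (p - q) = fps_of_int_poly p - fps_of_int_poly q"
  "fps_of_int_poly (p * q) = fps_of_int_poly p * fps_of_int_poly q"
  by (simp_all add: fps_of_int_poly_def map_poly_of_int_add map_poly_of_int_diff
      map_poly_of_int_mult fps_of_poly_add fps_of_poly_diff fps_of_poly_mult)

lemma fps_of_int_poly_eq_0_iff: "fps_of_int_poly p = 0 \<longleftrightarrow> p = 0"
proof -
  have "fps_of_int_poly p = 0 \<longleftrightarrow> (map_poly of_int p :: rat poly) = 0"
    unfolding fps_of_int_poly_def using fps_of_poly_eq_iff[of "map_poly of_int p" 0] by simp
  also have "\<dots> \<longleftrightarrow> p = 0"
    by (simp add: poly_eq_iff coeff_map_poly)
  finally show ?thesis .
qed

lemma fps_of_int_poly_monom: "fps_of_int_poly (monom 1 n) = fps_X ^ n"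
  by (simp add: fps_of_int_poly_def map_poly_monom fps_of_poly_monom')

lemma fps_of_int_poly_1: "fps_of_int_poly 1 = 1"
  by (simp add: fps_of_int_poly_def)

text \<open>Clearing the denominator leads from Laurent series back to \<open>rat fps\<close>, where
  the closure properties below become ring identities.\<close>

lemma is_rational_function_iff:
  "is_rational_function F \<longleftrightarrow>
     (\<exists>p q. q \<noteq> 0 \<and> F * fps_of_int_poly q = fps_of_int_poly p)"
proof -
  have "fps_to_fls F = fps_to_fls (fps_of_int_poly p) / fps_to_fls (fps_of_int_poly q) \<longleftrightarrow>
        F * fps_of_int_poly q = fps_of_int_poly p" if "q \<noteq> 0" for p q
  proof -
    have "fps_to_fls F = fps_to_fls (fps_of_int_poly p) / fps_to_fls (fps_of_int_poly q) \<longleftrightarrow>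
        fps_to_fls F * fps_to_fls (fps_of_int_poly q) = fps_to_fls (fps_of_int_poly p)"
      using that by (intro eq_divide_eq[THEN trans]) (simp add: fps_of_int_poly_eq_0_iff)
    then show ?thesis
      by (simp flip: fls_times_fps_to_fls)
  qed
  then show ?thesis
    unfolding is_rational_function_def fps_of_int_poly_def by blast
qed

lemma is_rational_function_mult_poly:
  assumes "is_rational_function F"
  shows "is_rational_function (F * fps_of_int_poly r)"
proof -
  obtain p q where "q \<noteq> 0" and p: "F * fps_of_int_poly q = fps_of_int_poly p"
    using assms unfolding is_rational_function_iff by blast
  have "(F * fps_of_int_poly r) * fps_of_int_poly q = fps_of_int_poly (p * r)"
    by (simp add: fps_of_int_poly_simps mult.commute mult.left_commute flip: p)
  then show ?thesis
    using \<open>q \<noteq> 0\<close> unfolding is_rational_function_iff by blast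
qed

text \<open>This lets rationality be read off from a linear equation for the series, such as F = F_0
  + z^k F.\<close>

lemma is_rational_function_cancel_poly:
  assumes "is_rational_function (F * fps_of_int_poly r)" "r \<noteq> 0"
  shows "is_rational_function F"
proof -
  obtain p q where "q \<noteq> 0" "(F * fps_of_int_poly r) * fps_of_int_poly q = fps_of_int_poly p"
    using assms unfolding is_rational_function_iff by blast
  then have "F * fps_of_int_poly (r * q) = fps_of_int_poly p" "r * q \<noteq> 0"
    using assms(2) by (simp_all add: fps_of_int_poly_simps mult.assoc)
  then show ?thesis
    unfolding is_rational_function_iff by blast
qed

lemma is_rational_function_add:
  assumes "is_rational_function F" "is_rational_function F'"
  shows "is_rational_function (F + F')"
proof -
  obtain p q p' q' where q: "q \<noteq> 0" "q' \<noteq> 0"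
    and p: "F * fps_of_int_poly q = fps_of_int_poly p"
      "F' * fps_of_int_poly q' = fps_of_int_poly p'"
    using assms unfolding is_rational_function_iff by blast
  have "(F + F') * fps_of_int_poly (q * q') = fps_of_int_poly (p * q' + p' * q)"
    by (simp add: fps_of_int_poly_simps algebra_simps flip: p)
  then show ?thesis
    using q unfolding is_rational_function_iff by (metis mult_eq_0_iff)
qed

lemma is_rational_function_of_poly: "is_rational_function (fps_of_int_poly p)"
  unfolding is_rational_function_iff
  by (intro exI[of _ p] exI[of _ 1]) (simp add: fps_of_int_poly_1)

lemma is_rational_function_diff:
  assumes "is_rational_function F" "is_rational_function F'"
  shows "is_rational_function (F - F')"
proof -
  have "fps_of_int_poly (0 - 1) = - 1"
    by (subst fps_of_int_poly_simps(2)) (simp add: fps_of_int_poly_1 fps_of_int_poly_eq_0_iff)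
  then show ?thesis
    using is_rational_function_add[OF assms(1) is_rational_function_mult_poly[OF assms(2), of "0 - 1"]]
    by simp
qed

section \<open>Graded sets with rational generating function\<close>

definition grade_series :: "('a \<Rightarrow> nat) \<Rightarrow> 'a set \<Rightarrow> rat fps" where
  "grade_series d X = Abs_fps (\<lambda>n. of_nat (card {x \<in> X. d x = n}))"

text \<open>Finiteness of each grade is demanded separately: \<open>card\<close> is 0 on infinite
  sets, so without it the series would not be additive over disjoint unions.\<close>

definition rational_set :: "('a \<Rightarrow> nat) \<Rightarrow> 'a set \<Rightarrow> bool" where
  "rational_set d X \<longleftrightarrow>
     (\<forall>n. finite {x \<in> X. d x = n}) \<and> is_rational_function (grade_series d X)"

lemma rational_set_empty: "rational_set d {}"
  using is_rational_function_of_poly[of 0]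
  by (simp add: rational_set_def grade_series_def fps_of_int_poly_def fps_zero_def)

lemma grade_series_Un:
  assumes "\<And>n. finite {x \<in> X. d x = n}" "\<And>n. finite {x \<in> Y. d x = n}" "X \<inter> Y = {}"
  shows "grade_series d (X \<union> Y) = grade_series d X + grade_series d Y"
proof (rule fps_ext)
  fix n
  have "{x \<in> X \<union> Y. d x = n} = {x \<in> X. d x = n} \<union> {x \<in> Y. d x = n}"
    by blast
  then have "card {x \<in> X \<union> Y. d x = n} = card {x \<in> X. d x = n} + card {x \<in> Y. d x = n}"
    using assms by (auto intro!: card_Un_disjoint)
  then show "grade_series d (X \<union> Y) $ n = (grade_series d X + grade_series d Y) $ n"
    by (simp add: grade_series_def)
qed

lemma rational_set_disjoint_Un:
  assumes "rational_set d X" "rational_set d Y" "X \<inter> Y = {}"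
  shows "rational_set d (X \<union> Y)"
proof -
  have "{x \<in> X \<union> Y. d x = n} = {x \<in> X. d x = n} \<union> {x \<in> Y. d x = n}" for n
    by blast
  then show ?thesis
    using assms grade_series_Un[of X d Y]
    by (auto simp: rational_set_def intro: is_rational_function_add)
qed

lemma rational_set_Diff:
  assumes "rational_set d X" "rational_set d Y" "Y \<subseteq> X"
  shows "rational_set d (X - Y)"
proof -
  have fin: "finite {x \<in> X - Y. d x = n}" for n
    using assms(1) unfolding rational_set_def by (auto intro: finite_subset[of _ "{x \<in> X. d x = n}"])
  have "grade_series d X = grade_series d (X - Y) + grade_series d Y"
    using grade_series_Un[of "X - Y" d Y] fin assms
    by (auto simp: rational_set_def Un_absorb2)
  then have "grade_series d (X - Y) = grade_series d X - grade_series d Y"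
    by simp
  then show ?thesis
    using fin assms by (simp add: rational_set_def is_rational_function_diff)
qed

lemma rational_set_Un:
  assumes "rational_set d X" "rational_set d Y" "rational_set d (X \<inter> Y)"
  shows "rational_set d (X \<union> Y)"
proof -
  have "rational_set d (X - X \<inter> Y)"
    using assms by (intro rational_set_Diff) auto
  then have "rational_set d ((X - X \<inter> Y) \<union> Y)"
    using assms by (intro rational_set_disjoint_Un) auto
  moreover have "(X - X \<inter> Y) \<union> Y = X \<union> Y"
    by blast
  ultimately show ?thesis
    by simp
qed

lemma rational_set_UN_disjoint:
  assumes "finite I" "\<And>i. i \<in> I \<Longrightarrow> rational_set d (X i)"
    and "\<And>i j. i \<in> I \<Longrightarrow> j \<in> I \<Longrightarrow> i \<noteq> j \<Longrightarrow> X i \<inter> X j = {}"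
  shows "rational_set d (\<Union>i\<in>I. X i)"
  using assms
proof (induction I rule: finite_induct)
  case empty
  show ?case by (simp add: rational_set_empty)
next
  case (insert i I)
  have "X i \<inter> (\<Union>i\<in>I. X i) = {}"
    using insert.hyps(2) insert.prems(2) by fastforce
  then show ?case
    using insert by (auto intro!: rational_set_disjoint_Un)
qed

text \<open>Inclusion-exclusion, one set \<open>X\<close> at a time: \<open>X\<close> meets the
  union of the other sets in the union of the pairwise intersections, which are again fewer than
  \<open>card \<F>\<close> members of \<A>. These need not belong to \<F>, hence the induction on
  the cardinality over all families.\<close>

lemma rational_set_Union:
  assumes inter: "\<And>X Y. X \<in> \<A> \<Longrightarrow> Y \<in> \<A> \<Longrightarrow> X \<inter> Y \<in> \<A>"
    and rat: "\<And>X. X \<in> \<A> \<Longrightarrow> rational_set d X"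
    and "finite \<F>" "\<F> \<subseteq> \<A>"
  shows "rational_set d (\<Union>\<F>)"
  using assms(3,4)
proof (induction "card \<F>" arbitrary: \<F> rule: less_induct)
  case less
  show ?case
  proof (cases "\<F> = {}")
    case True
    then show ?thesis by (simp add: rational_set_empty)
  next
    case False
    then obtain X where X: "X \<in> \<F>" by blast
    define \<G> where "\<G> = \<F> - {X}"
    have "finite \<G>" "card \<G> < card \<F>" "\<G> \<subseteq> \<A>"
      using less.prems X card_Diff1_less[of \<F> X] by (auto simp: \<G>_def)
    moreover have "card ((\<inter>) X ` \<G>) < card \<F>"
      using calculation card_image_le[of \<G> "(\<inter>) X"] by simp
    moreover have "(\<inter>) X ` \<G> \<subseteq> \<A>"
      using \<open>\<G> \<subseteq> \<A>\<close> X less.prems(2) inter by blast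
    ultimately have "rational_set d (\<Union>\<G>)" "rational_set d (\<Union>((\<inter>) X ` \<G>))"
      using less.hyps by blast+
    moreover have "rational_set d X"
      using X less.prems(2) rat by blast
    moreover have "X \<inter> \<Union>\<G> = \<Union>((\<inter>) X ` \<G>)" "\<Union>\<F> = X \<union> \<Union>\<G>"
      using X by (auto simp: \<G>_def)
    ultimately show ?thesis
      using rational_set_Un[of d X "\<Union>\<G>"] by (simp only:)
  qed
qed

lemma grade_series_image_shift:
  assumes "inj_on f X" "\<And>x. x \<in> X \<Longrightarrow> d' (f x) = d x + k"
  shows "grade_series d' (f ` X) = grade_series d X * fps_X ^ k"
proof (rule fps_ext)
  fix n
  have "{y \<in> f ` X. d' y = n} = f ` {x \<in> X. d x + k = n}"
    using assms(2) by auto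
  then have "card {y \<in> f ` X. d' y = n} = card {x \<in> X. d x + k = n}"
    using inj_on_subset[OF assms(1)] by (simp add: card_image)
  \<comment> \<open>For \<open>n < k\<close> the truncated difference \<open>n - k\<close> would
    wrongly select grade 0.\<close>
  moreover have "{x \<in> X. d x + k = n} = (if n < k then {} else {x \<in> X. d x = n - k})"
    by auto
  ultimately show "grade_series d' (f ` X) $ n = (grade_series d X * fps_X ^ k) $ n"
    by (simp add: grade_series_def fps_X_power_mult_right_nth)
qed

lemma rational_set_image_shift:
  assumes "rational_set d X" "inj_on f X" "\<And>x. x \<in> X \<Longrightarrow> d' (f x) = d x + k"
  shows "rational_set d' (f ` X)"
proof -
  have "finite {y \<in> f ` X. d' y = n}" for n
  proof (rule finite_subset)
    show "{y \<in> f ` X. d' y = n} \<subseteq> f ` {x \<in> X. d x = n - k}"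
      using assms(3) by auto
    show "finite (f ` {x \<in> X. d x = n - k})"
      using assms(1) by (simp add: rational_set_def)
  qed
  then show ?thesis
    using grade_series_image_shift[of f X d' d k] assms
      is_rational_function_mult_poly[of "grade_series d X" "monom 1 k"]
    by (simp add: rational_set_def fps_of_int_poly_monom)
qed

section \<open>Dickson's lemma and upward closed sets of multisets\<close>

text \<open>There is a monotone subsequence; if it is nonincreasing, it attains its least value and
  is constant from there on.\<close>

lemma nat_seq_incseq_subseq:
  fixes s :: "nat \<Rightarrow> nat"
  shows "\<exists>r. strict_mono r \<and> incseq (s \<circ> r)"
proof -
  obtain r where r: "strict_mono r" "monoseq (\<lambda>n. s (r n))"
    using seq_monosub[of s] by blast
  show ?thesis
  proof (cases "incseq (s \<circ> r)")
    case False
    then have dec: "decseq (\<lambda>n. s (r n))"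
      using r(2) by (auto simp: monoseq_iff o_def)
    define m where "m = (LEAST v. \<exists>n. s (r n) = v)"
    obtain n0 where n0: "s (r n0) = m"
      unfolding m_def using LeastI[of "\<lambda>v. \<exists>n. s (r n) = v" "s (r 0)"] by blast
    have "s (r (n + n0)) = m" for n
    proof (rule antisym)
      show "s (r (n + n0)) \<le> m"
        using decseqD[OF dec, of n0 "n + n0"] n0 by simp
      show "m \<le> s (r (n + n0))"
        unfolding m_def by (rule Least_le) blast
    qed
    then have "incseq (s \<circ> (\<lambda>n. r (n + n0)))"
      by (simp add: incseq_def)
    moreover have "strict_mono (\<lambda>n. r (n + n0))"
      using r(1) by (simp add: strict_mono_def)
    ultimately show ?thesis by blast
  qed (use r in blast)
qed

text \<open>The sequence is thinned out for one element of \<open>Q\<close> after another;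
  multiplicities that are already nondecreasing remain so on subsequences.\<close>

lemma multiset_seq_incseq_subseq:
  fixes M :: "nat \<Rightarrow> 'a multiset"
  assumes "finite Q" "\<And>n. set_mset (M n) \<subseteq> Q"
  shows "\<exists>r :: nat \<Rightarrow> nat. strict_mono r \<and> (\<forall>i j. i \<le> j \<longrightarrow> M (r i) \<subseteq># M (r j))"
proof -
  have "\<exists>r :: nat \<Rightarrow> nat. strict_mono r \<and> (\<forall>q\<in>Q. incseq (\<lambda>n. count (M (r n)) q))"
    using assms(1)
  proof (induction Q rule: finite_induct)
    case empty
    show ?case by (rule exI[of _ id]) (simp add: strict_mono_def)
  next
    case (insert q Q)
    then obtain r where r: "strict_mono r" "\<forall>q\<in>Q. incseq (\<lambda>n. count (M (r n)) q)"
      by blast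
    obtain r' where r': "strict_mono r'" "incseq ((\<lambda>n. count (M (r n)) q) \<circ> r')"
      using nat_seq_incseq_subseq by blast
    have "strict_mono (r \<circ> r')"
      using r(1) r'(1) by (simp add: strict_mono_def)
    moreover have "\<forall>q\<in>Q. incseq (\<lambda>n. count (M ((r \<circ> r') n)) q)"
      using r(2) strict_mono_mono[OF r'(1)] by (auto simp: incseq_def mono_def)
    ultimately show ?case
      using r'(2) by (intro exI[of _ "r \<circ> r'"]) (simp add: o_def)
  qed
  then obtain r where r: "strict_mono r" "\<forall>q\<in>Q. incseq (\<lambda>n. count (M (r n)) q)"
    by blast
  have "M (r i) \<subseteq># M (r j)" if "i \<le> j" for i j
  proof (rule mset_subset_eqI)
    fix q
    show "count (M (r i)) q \<le> count (M (r j)) q"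
    proof (cases "q \<in> Q")
      case True
      then show ?thesis using r(2) that by (auto simp: incseq_def)
    next
      case False
      then have "q \<notin># M (r i)" using assms(2)[of "r i"] by blast
      then show ?thesis by (simp add: not_in_iff)
    qed
  qed
  then show ?thesis using r(1) by blast
qed

text \<open>The minimal elements of \<open>T\<close> form an antichain, which is finite because an
  infinite one would contain a nondecreasing sequence of distinct multisets. Descent on the size
  shows that each element lies above a minimal one.\<close>

lemma Dickson_multiset:
  assumes "finite Q" "\<And>M. M \<in> T \<Longrightarrow> set_mset M \<subseteq> Q"
  shows "\<exists>J. finite J \<and> J \<subseteq> T \<and> (\<forall>M\<in>T. \<exists>N\<in>J. N \<subseteq># M)"
proof -
  define J where "J = {M \<in> T. \<forall>N\<in>T. \<not> N \<subset># M}"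
  have "finite J"
  proof (rule ccontr)
    assume "infinite J"
    then obtain M :: "nat \<Rightarrow> 'a multiset" where M: "inj M" "range M \<subseteq> J"
      using infinite_countable_subset by blast
    have "set_mset (M n) \<subseteq> Q" for n
      using M(2) assms(2) by (auto simp: J_def)
    then obtain r :: "nat \<Rightarrow> nat" where r: "strict_mono r" "\<forall>i j. i \<le> j \<longrightarrow> M (r i) \<subseteq># M (r j)"
      using multiset_seq_incseq_subseq[of Q M] assms(1) by blast
    have "M (r 0) \<subseteq># M (r 1)"
      using r(2) by simp
    moreover have "M (r 0) \<noteq> M (r 1)"
      using M(1) strict_monoD[OF r(1), of 0 1] by (auto dest: injD)
    ultimately have "M (r 0) \<subset># M (r 1)"
      by (simp add: subset_mset.less_le)
    moreover have "M (r 0) \<in> J" "M (r 1) \<in> J"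
      using M(2) by blast+
    ultimately show False
      unfolding J_def by blast
  qed
  moreover have "\<exists>N\<in>J. N \<subseteq># M" if "M \<in> T" for M
    using that
  proof (induction "size M" arbitrary: M rule: less_induct)
    case less
    show ?case
    proof (cases "M \<in> J")
      case False
      then obtain N where N: "N \<in> T" "N \<subset># M"
        using less.prems by (auto simp: J_def)
      then obtain N' where "N' \<in> J" "N' \<subseteq># N"
        using less.hyps[OF mset_subset_size[OF N(2)] N(1)] by blast
      then show ?thesis
        using subset_mset.order_trans[OF _ subset_mset.less_imp_le[OF N(2)]] by blast
    qed auto
  qed
  ultimately show ?thesis
    by (intro exI[of _ J]) (auto simp: J_def)
qed

section \<open>Weight series of sets of multisets over a finite alphabet\<close>

definition mset_over :: "'a set \<Rightarrow> 'a multiset set" where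
  "mset_over Q = {M. set_mset M \<subseteq> Q}"

lemma mset_over_simps [simp]:
  "{#} \<in> mset_over Q"
  "add_mset q M \<in> mset_over Q \<longleftrightarrow> q \<in> Q \<and> M \<in> mset_over Q"
  "M + N \<in> mset_over Q \<longleftrightarrow> M \<in> mset_over Q \<and> N \<in> mset_over Q"
  by (auto simp: mset_over_def)

lemma size_le_sum_mset_weight:
  fixes w :: "'a \<Rightarrow> nat"
  assumes "\<And>q. q \<in># M \<Longrightarrow> w q > 0"
  shows "size M \<le> (\<Sum>q\<in>#M. w q)"
  using assms
proof (induction M)
  case (add q M)
  then have "size M \<le> (\<Sum>q\<in>#M. w q)" "w q > 0"
    by simp_all
  then show ?case by simp
qed simp

lemma finite_mset_over_weight:
  fixes w :: "'a \<Rightarrow> nat"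
  assumes "finite Q" "\<And>q. q \<in> Q \<Longrightarrow> w q > 0"
  shows "finite {M \<in> mset_over Q. (\<Sum>q\<in>#M. w q) = n}"
proof (rule finite_subset)
  show "{M \<in> mset_over Q. (\<Sum>q\<in>#M. w q) = n} \<subseteq> (\<Union>k\<le>n. multisets_of_size Q k)"
  proof
    fix M assume M: "M \<in> {M \<in> mset_over Q. (\<Sum>q\<in>#M. w q) = n}"
    then have "size M \<le> n"
      using size_le_sum_mset_weight[of M w] assms(2) by (auto simp: mset_over_def)
    then show "M \<in> (\<Union>k\<le>n. multisets_of_size Q k)"
      using M by (auto simp: mset_over_def multisets_of_size_def)
  qed
  show "finite (\<Union>k\<le>n. multisets_of_size Q k)"
    using assms(1) by auto
qed

text \<open>Separating the multisets without \<open>q\<close> from the others gives F = F_Q + z^(w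
  q) F, so the series is the product of the factors 1/(1 - z^(w q)).\<close>

lemma rational_set_mset_over:
  fixes w :: "'a \<Rightarrow> nat"
  assumes "finite Q" "\<And>q. q \<in> Q \<Longrightarrow> w q > 0"
  shows "rational_set (\<lambda>M. \<Sum>q\<in>#M. w q) (mset_over Q)"
  using assms
proof (induction Q rule: finite_induct)
  case empty
  have "{M \<in> mset_over {}. (\<Sum>q\<in>#M. w q) = n} = (if n = 0 then {{#} :: 'a multiset} else {})" for n
    by (auto simp: mset_over_def)
  then have "grade_series (\<lambda>M. \<Sum>q\<in>#M. w q) (mset_over ({} :: 'a set)) = fps_of_int_poly 1"
    by (simp add: grade_series_def fps_of_int_poly_1 fps_eq_iff)
  then show ?case
    using is_rational_function_of_poly[of 1] finite_mset_over_weight[of "{}" w]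
    by (simp add: rational_set_def)
next
  case (insert q Q)
  let ?d = "\<lambda>M. \<Sum>q\<in>#M. w q" and ?A = "mset_over (insert q Q)"
  have fin: "finite {M \<in> ?A. ?d M = n}" for n
    using insert by (intro finite_mset_over_weight) auto
  have img: "?A = mset_over Q \<union> add_mset q ` ?A"
  proof (intro equalityI subsetI)
    fix M assume M: "M \<in> ?A"
    show "M \<in> mset_over Q \<union> add_mset q ` ?A"
    proof (cases "q \<in># M")
      case True
      then obtain N where "M = add_mset q N" by (metis insert_DiffM)
      then show ?thesis using M by auto
    qed (use M in \<open>auto simp: mset_over_def\<close>)
  qed (auto simp: mset_over_def)
  have fin': "finite {M \<in> mset_over Q. ?d M = n}" "finite {M \<in> add_mset q ` ?A. ?d M = n}" for n
    using img by (auto intro!: finite_subset[OF _ fin[of n]])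
  have "mset_over Q \<inter> add_mset q ` ?A = {}"
    using insert.hyps(2) by (auto simp: mset_over_def)
  then have "grade_series ?d ?A = grade_series ?d (mset_over Q) + grade_series ?d (add_mset q ` ?A)"
    using grade_series_Un[of "mset_over Q" ?d "add_mset q ` ?A"] fin' img by auto
  also have "grade_series ?d (add_mset q ` ?A) = grade_series ?d ?A * fps_X ^ w q"
    by (rule grade_series_image_shift) (auto simp: inj_on_def)
  finally have "grade_series ?d ?A - grade_series ?d ?A * fps_X ^ w q = grade_series ?d (mset_over Q)"
    by (metis add_diff_cancel_right')
  then have "grade_series ?d ?A * fps_of_int_poly (1 - monom 1 (w q)) =
                  grade_series ?d (mset_over Q)"
    by (simp add: fps_of_int_poly_simps fps_of_int_poly_1 fps_of_int_poly_monom right_diff_distrib)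
  \<comment> \<open>As the weight is positive, the constant coefficient is 1.\<close>
  moreover have "1 - monom (1 :: int) (w q) \<noteq> 0"
    using insert.prems[of q] by (auto simp: poly_eq_iff dest!: spec[of _ 0])
  moreover have "is_rational_function (grade_series ?d (mset_over Q))"
    using insert by (simp add: rational_set_def)
  ultimately show ?case
    using fin is_rational_function_cancel_poly by (metis rational_set_def)
qed

text \<open>By Dickson's lemma \<open>U\<close> is a finite union of principal upward closed sets.
  Two of these meet in the one generated by \<open>M \<union># N\<close>, so inclusion-exclusion
  applies, and each is a shifted copy of \<open>mset_over Q\<close>.\<close>

lemma rational_set_upward_closed:
  fixes w :: "'a \<Rightarrow> nat"
  assumes "finite Q" "\<And>q. q \<in> Q \<Longrightarrow> w q > 0"
    and "U \<subseteq> mset_over Q" "\<And>M N. M \<in> U \<Longrightarrow> N \<in> mset_over Q \<Longrightarrow> M + N \<in> U"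
  shows "rational_set (\<lambda>M. \<Sum>q\<in>#M. w q) U"
proof -
  define up where "up M = (+) M ` mset_over Q" for M
  have up_iff: "N \<in> up M \<longleftrightarrow> N \<in> mset_over Q \<and> M \<subseteq># N" if "M \<in> mset_over Q" for M N
    using that by (auto simp: up_def mset_subset_eq_exists_conv)
  have inter: "up M \<inter> up N = up (M \<union># N)" if "M \<in> mset_over Q" "N \<in> mset_over Q" for M N
  proof -
    have "M \<union># N \<in> mset_over Q"
      using that by (auto simp: mset_over_def)
    then show ?thesis
      using that by (auto simp: up_iff)
  qed
  obtain J where J: "finite J" "J \<subseteq> U" "\<forall>M\<in>U. \<exists>N\<in>J. N \<subseteq># M"
    using Dickson_multiset[of Q U] assms(1,3) unfolding mset_over_def by blast
  have "U = \<Union>(up ` J)"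
  proof (intro equalityI subsetI)
    fix M assume M: "M \<in> U"
    then obtain N where N: "N \<in> J" "N \<subseteq># M"
      using J(3) by blast
    then have "M \<in> up N"
      using M J(2) assms(3) up_iff[of N M] by blast
    then show "M \<in> \<Union>(up ` J)"
      using N(1) by blast
  next
    fix M assume "M \<in> \<Union>(up ` J)"
    then show "M \<in> U"
      using J(2) assms(4) unfolding up_def by blast
  qed
  moreover have "rational_set (\<lambda>M. \<Sum>q\<in>#M. w q) (\<Union>(up ` J))"
  proof (rule rational_set_Union[where \<A> = "up ` mset_over Q"])
    show "X \<inter> Y \<in> up ` mset_over Q" if "X \<in> up ` mset_over Q" "Y \<in> up ` mset_over Q" for X Y
    proof -
      obtain M N where "M \<in> mset_over Q" "X = up M" "N \<in> mset_over Q" "Y = up N"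
        using \<open>X \<in> _\<close> \<open>Y \<in> _\<close> by blast
      then show ?thesis
        using inter[of M N] by (auto simp: mset_over_def)
    qed
    show "rational_set (\<lambda>M. \<Sum>q\<in>#M. w q) X" if X_in: "X \<in> up ` mset_over Q" for X
    proof -
      obtain M where X: "X = (+) M ` mset_over Q"
        using X_in unfolding up_def by blast
      show ?thesis
        unfolding X
      proof (rule rational_set_image_shift[where k = "\<Sum>q\<in>#M. w q"])
        show "rational_set (\<lambda>M. \<Sum>q\<in>#M. w q) (mset_over Q)"
          by (rule rational_set_mset_over[OF assms(1,2)])
      qed (simp_all add: inj_on_def)
    qed
    show "finite (up ` J)" "up ` J \<subseteq> up ` mset_over Q"
      using J assms(3) by blast+
  qed
  ultimately show ?thesis by simp
qed

section \<open>Finitely generated sets in a graded commutative monoid modulo a congruence\<close>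

text \<open>The submonoid generated by \<open>Q\<close>, presented as a quotient of the free
  commutative monoid so that statements about multisets carry over.\<close>

definition mset_span :: "'g::comm_monoid_add set \<Rightarrow> 'g set" where
  "mset_span Q = sum_mset ` mset_over Q"

lemma mset_span_0 [simp]: "0 \<in> mset_span Q"
  unfolding mset_span_def by (rule image_eqI[of _ _ "{#}"]) simp_all

lemma mset_span_superset: "q \<in> Q \<Longrightarrow> q \<in> mset_span Q"
  unfolding mset_span_def by (rule image_eqI[of _ _ "{#q#}"]) simp_all

lemma mset_span_add [simp]:
  assumes "x \<in> mset_span Q" "y \<in> mset_span Q"
  shows "x + y \<in> mset_span Q"
proof -
  obtain M N where "M \<in> mset_over Q" "N \<in> mset_over Q" "x = sum_mset M" "y = sum_mset N"
    using assms unfolding mset_span_def by blast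
  then show ?thesis
    unfolding mset_span_def by (intro image_eqI[of _ _ "M + N"]) simp_all
qed

lemma mset_span_induct [consumes 1, case_names zero add]:
  assumes "x \<in> mset_span Q" "P 0"
    and "\<And>q x. q \<in> Q \<Longrightarrow> x \<in> mset_span Q \<Longrightarrow> P x \<Longrightarrow> P (q + x)"
  shows "P x"
proof -
  obtain M where "M \<in> mset_over Q" "x = sum_mset M"
    using assms(1) unfolding mset_span_def by blast
  then show ?thesis
  proof (induction M arbitrary: x)
    case empty
    then show ?case using assms(2) by simp
  next
    case (add q M)
    then have "sum_mset M \<in> mset_span Q" unfolding mset_span_def by simp
    then show ?case using add assms(3)[of q "sum_mset M"] by simp
  qed
qed

lemma mset_span_least:
  assumes "x \<in> mset_span Q" "Q \<subseteq> P" "0 \<in> P" "\<And>x y. x \<in> P \<Longrightarrow> y \<in> P \<Longrightarrow> x + y \<in> P"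
  shows "x \<in> P"
  using assms(1) by (induction rule: mset_span_induct) (use assms in auto)

lemma mset_span_image:
  assumes "f 0 = 0" "\<And>x y. f (x + y) = f x + f y"
  shows "mset_span (f ` Q) = f ` mset_span Q"
proof (intro equalityI subsetI)
  fix y assume "y \<in> mset_span (f ` Q)"
  then show "y \<in> f ` mset_span Q"
  proof (rule mset_span_least)
    show "f ` Q \<subseteq> f ` mset_span Q"
      using mset_span_superset by blast
    show "0 \<in> f ` mset_span Q"
      using assms(1) by (metis image_eqI mset_span_0)
    show "x + y \<in> f ` mset_span Q" if "x \<in> f ` mset_span Q" "y \<in> f ` mset_span Q" for x y
      using that by (auto simp flip: assms(2))
  qed
next
  fix y assume "y \<in> f ` mset_span Q"
  then obtain x where "x \<in> mset_span Q" "y = f x" by blast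
  then show "y \<in> mset_span (f ` Q)"
    by (induction arbitrary: y rule: mset_span_induct)
      (auto simp: assms intro!: mset_span_add intro: mset_span_superset)
qed

text \<open>Minimal nonzero elements of the monoid generate it, since the difference of two comparable
  elements stays inside; this replaces Gordan's lemma.\<close>

lemma mset_submonoid_finitely_generated:
  assumes "finite Q" "H \<subseteq> mset_over Q" "{#} \<in> H"
    and add: "\<And>x y. x \<in> H \<Longrightarrow> y \<in> H \<Longrightarrow> x + y \<in> H"
    and diff: "\<And>x y. x \<in> H \<Longrightarrow> x + y \<in> H \<Longrightarrow> y \<in> H"
  shows "\<exists>B. finite B \<and> B \<subseteq> H - {{#}} \<and> H = mset_span B"
proof -
  obtain B where B: "finite B" "B \<subseteq> H - {{#}}" "\<forall>x\<in>H - {{#}}. \<exists>b\<in>B. b \<subseteq># x"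
    using Dickson_multiset[of Q "H - {{#}}"] assms(1,2) unfolding mset_over_def by blast
  have "x \<in> mset_span B" if "x \<in> H" for x
    using that
  proof (induction "size x" arbitrary: x rule: less_induct)
    case less
    show ?case
    proof (cases "x = {#}")
      case False
      then obtain b y where b: "b \<in> B" "x = b + y"
        using B(3) less.prems by (metis DiffI mset_subset_eq_exists_conv singletonD)
      then have "y \<in> H" "b \<noteq> {#}"
        using B(2) diff[of b y] less.prems by auto
      then have "y \<in> mset_span B"
        using less.hyps[of y] b(2) by (simp add: nonempty_has_size)
      then show ?thesis
        using b mset_span_superset[of b B] by simp
    qed (metis empty_not_add_mset mset_span_0)
  qed
  moreover have "x \<in> H" if "x \<in> mset_span B" for x
    using that by (rule mset_span_least) (use B(2) assms(3) add in auto)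
  ultimately show ?thesis
    using B(1,2) by blast
qed

text \<open>\<open>H\<close> plays the part of the homogeneous solutions and \<open>T\<close> that
  of the inhomogeneous ones. The minimal elements of \<open>T\<close> serve as the translations, and
  \<open>diff\<close> places the remainder above them in \<open>H\<close>.\<close>

lemma mset_coset_finitely_generated:
  assumes "finite Q" "T \<subseteq> mset_over Q"
    and add: "\<And>x y. x \<in> T \<Longrightarrow> y \<in> H \<Longrightarrow> x + y \<in> T"
    and diff: "\<And>x y. x \<in> T \<Longrightarrow> x + y \<in> T \<Longrightarrow> y \<in> H"
  shows "\<exists>J. finite J \<and> J \<subseteq> T \<and> T = (\<Union>j\<in>J. (+) j ` H)"
proof -
  obtain J where J: "finite J" "J \<subseteq> T" "\<forall>x\<in>T. \<exists>j\<in>J. j \<subseteq># x"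
    using Dickson_multiset[of Q T] assms(1,2) unfolding mset_over_def by blast
  have "x \<in> (\<Union>j\<in>J. (+) j ` H)" if x: "x \<in> T" for x
  proof -
    obtain j h where "j \<in> J" "x = j + h"
      using J(3) x by (metis mset_subset_eq_exists_conv)
    moreover have "h \<in> H"
      using diff[of j h] calculation x J(2) by blast
    ultimately show ?thesis by auto
  qed
  moreover have "(\<Union>j\<in>J. (+) j ` H) \<subseteq> T"
    using J(2) add by auto
  ultimately show ?thesis
    using J(1,2) by blast
qed

text \<open>The kernel of \<phi> is a cancellative congruence that respects the grading. Expressing
  it through \<phi> requires no monoid structure on the type of values.\<close>

locale graded_congruence =
  fixes \<phi> :: "'g::cancel_comm_monoid_add \<Rightarrow> 'b" and d :: "'b \<Rightarrow> nat"
  assumes translate_iff: "\<phi> (x + z) = \<phi> (y + z) \<longleftrightarrow> \<phi> x = \<phi> y"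
    and grade_add: "d (\<phi> (x + y)) = d (\<phi> x) + d (\<phi> y)"
begin

text \<open>Images of semilinear sets whose translates share one finite generating set. Positive
  grades of the generators are what the rationality of the series rests on.\<close>

definition fg_sets :: "'b set set" where
  "fg_sets = {Y. \<exists>J Q. finite J \<and> finite Q \<and> (\<forall>q\<in>Q. d (\<phi> q) > 0) \<and>
     Y = (\<Union>j\<in>J. (\<lambda>x. \<phi> (j + x)) ` mset_span Q)}"

lemma grade_0 [simp]: "d (\<phi> 0) = 0"
  using grade_add[of 0 0] by simp

lemma translate_iff_left: "\<phi> (z + x) = \<phi> (z + y) \<longleftrightarrow> \<phi> x = \<phi> y"
  using translate_iff[of x z y] by (simp add: add.commute)

lemma add_cong: "\<phi> x = \<phi> x' \<Longrightarrow> \<phi> y = \<phi> y' \<Longrightarrow> \<phi> (x + y) = \<phi> (x' + y')"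
  using translate_iff[of x y x'] translate_iff_left[of x' y y'] by simp

lemma add_cong_cancel: "\<phi> x = \<phi> x' \<Longrightarrow> \<phi> (x + y) = \<phi> (x' + y') \<Longrightarrow> \<phi> y = \<phi> y'"
  using translate_iff[of x y x'] translate_iff_left[of x' y y'] by simp

text \<open>An element of the intersection has a representation on either side. The pairs of
  representations with equal value solve a linear equation modulo the congruence, so they form
  finitely many translates of a finitely generated monoid, and projecting to the first side
  preserves this form.\<close>

lemma fg_sets_Int:
  assumes "Y\<^sub>1 \<in> fg_sets" "Y\<^sub>2 \<in> fg_sets"
  shows "Y\<^sub>1 \<inter> Y\<^sub>2 \<in> fg_sets"
proof -
  obtain J\<^sub>1 Q\<^sub>1 where 1: "finite J\<^sub>1" "finite Q\<^sub>1" "\<forall>q\<in>Q\<^sub>1. d (\<phi> q) > 0"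
    "Y\<^sub>1 = (\<Union>j\<in>J\<^sub>1. (\<lambda>x. \<phi> (j + x)) ` mset_span Q\<^sub>1)"
    using assms(1) unfolding fg_sets_def by blast
  obtain J\<^sub>2 Q\<^sub>2 where 2: "finite J\<^sub>2" "finite Q\<^sub>2" "\<forall>q\<in>Q\<^sub>2. d (\<phi> q) > 0"
    "Y\<^sub>2 = (\<Union>j\<in>J\<^sub>2. (\<lambda>x. \<phi> (j + x)) ` mset_span Q\<^sub>2)"
    using assms(2) unfolding fg_sets_def by blast
  \<comment> \<open>One multiset over the disjoint union encodes a pair of representations;
    \<open>l\<close> and \<open>r\<close> read off the two sums.\<close>
  define Q :: "('g + 'g) set" where "Q = Q\<^sub>1 <+> Q\<^sub>2"
  define l where "l x = (\<Sum>s\<in>#x. case s of Inl g \<Rightarrow> g | Inr _ \<Rightarrow> 0)" for x :: "('g + 'g) multiset"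
  define r where "r x = (\<Sum>s\<in>#x. case s of Inl _ \<Rightarrow> 0 | Inr g \<Rightarrow> g)" for x :: "('g + 'g) multiset"
  have lr_simps [simp]: "l 0 = 0" "r 0 = 0" "l (x + y) = l x + l y" "r (x + y) = r x + r y" for x y
    by (simp_all add: l_def r_def)
  have lr_span: "l x \<in> mset_span Q\<^sub>1" "r x \<in> mset_span Q\<^sub>2" if "x \<in> mset_over Q" for x
    using that by (induction x)
      (auto simp: l_def r_def Q_def split: sum.splits intro!: mset_span_add intro: mset_span_superset)
  have lr_surj: "\<exists>x\<in>mset_over Q. l x = u \<and> r x = v"
    if "u \<in> mset_span Q\<^sub>1" "v \<in> mset_span Q\<^sub>2" for u v
  proof -
    obtain M N where "M \<in> mset_over Q\<^sub>1" "u = sum_mset M" "N \<in> mset_over Q\<^sub>2" "v = sum_mset N"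
      using \<open>u \<in> _\<close> \<open>v \<in> _\<close> unfolding mset_span_def by blast
    moreover have "sum_mset (image_mset (\<lambda>_. 0 :: 'g) K) = 0" for K :: "'g multiset"
      by (induction K) simp_all
    ultimately show ?thesis
      by (intro bexI[of _ "image_mset Inl M + image_mset Inr N"])
        (auto simp: l_def r_def Q_def mset_over_def multiset.map_comp o_def)
  qed
  have finQ: "finite Q"
    using 1(2) 2(2) by (simp add: Q_def)
  \<comment> \<open>The homogeneous equation, and below it the equation with the offsets
    \<open>j\<close> and \<open>k\<close>.\<close>
  define H where "H = {x \<in> mset_over Q. \<phi> (l x) = \<phi> (r x)}"
  define T where "T j k = {x \<in> mset_over Q. \<phi> (j + l x) = \<phi> (k + r x)}" for j k
  have "\<exists>B. finite B \<and> B \<subseteq> H - {{#}} \<and> H = mset_span B"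
  proof (rule mset_submonoid_finitely_generated[OF finQ])
    show "{#} \<in> H"
      using lr_simps(1,2) by (simp add: H_def)
    show "x + y \<in> H" if "x \<in> H" "y \<in> H" for x y
      using that by (auto simp: H_def intro: add_cong)
    show "y \<in> H" if "x \<in> H" "x + y \<in> H" for x y
      using that add_cong_cancel[of "l x" "r x" "l y" "r y"] by (auto simp: H_def)
  qed (auto simp: H_def)
  then obtain B where B: "finite B" "B \<subseteq> H - {{#}}" "H = mset_span B"
    by blast
  have "\<exists>J. finite J \<and> J \<subseteq> T j k \<and> T j k = (\<Union>i\<in>J. (+) i ` H)" for j k
  proof (rule mset_coset_finitely_generated[OF finQ])
    show "x + y \<in> T j k" if "x \<in> T j k" "y \<in> H" for x y
      using that add_cong[of "j + l x" "k + r x" "l y" "r y"] by (auto simp: T_def H_def add.assoc)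
    show "y \<in> H" if "x \<in> T j k" "x + y \<in> T j k" for x y
      using that add_cong_cancel[of "j + l x" "k + r x" "l y" "r y"]
      by (auto simp: T_def H_def add.assoc)
  qed (auto simp: T_def)
  then have "\<forall>jk. \<exists>I. finite I \<and> I \<subseteq> T (fst jk) (snd jk) \<and>
      T (fst jk) (snd jk) = (\<Union>i\<in>I. (+) i ` H)"
    by blast
  then obtain I' where I': "\<forall>jk. finite (I' jk) \<and> I' jk \<subseteq> T (fst jk) (snd jk) \<and>
      T (fst jk) (snd jk) = (\<Union>i\<in>I' jk. (+) i ` H)"
    by (rule choice[THEN exE])
  define I where "I j k = I' (j, k)" for j k
  have I: "finite (I j k)" "T j k = (\<Union>i\<in>I j k. (+) i ` H)" for j k
    using I'[rule_format, of "(j, k)"] by (simp_all add: I_def)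
  define J where "J = (\<Union>j\<in>J\<^sub>1. \<Union>k\<in>J\<^sub>2. (\<lambda>i. j + l i) ` I j k)"
  have "Y\<^sub>1 \<inter> Y\<^sub>2 = (\<Union>j\<in>J. (\<lambda>x. \<phi> (j + x)) ` mset_span (l ` B))"
  proof (intro equalityI subsetI)
    fix y assume y: "y \<in> Y\<^sub>1 \<inter> Y\<^sub>2"
    then obtain j u k v where jk: "j \<in> J\<^sub>1" "u \<in> mset_span Q\<^sub>1" "y = \<phi> (j + u)"
        "k \<in> J\<^sub>2" "v \<in> mset_span Q\<^sub>2" "y = \<phi> (k + v)"
      unfolding 1 2 by blast
    then obtain x where x: "x \<in> mset_over Q" "l x = u" "r x = v"
      using lr_surj by blast
    then have "x \<in> T j k"
      using jk by (simp add: T_def)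
    then obtain i h where ih: "i \<in> I j k" "h \<in> H" "x = i + h"
      using I(2)[of j k] by blast
    then have "y = \<phi> ((j + l i) + l h)"
      using x jk by (simp add: add.assoc)
    moreover have "j + l i \<in> J"
      using ih jk by (auto simp: J_def)
    moreover have "l h \<in> mset_span (l ` B)"
      using ih(2) B(3) by (simp add: mset_span_image)
    ultimately show "y \<in> (\<Union>j\<in>J. (\<lambda>x. \<phi> (j + x)) ` mset_span (l ` B))"
      by blast
  next
    fix y assume "y \<in> (\<Union>j\<in>J. (\<lambda>x. \<phi> (j + x)) ` mset_span (l ` B))"
    then obtain j k i h where jk: "j \<in> J\<^sub>1" "k \<in> J\<^sub>2" "i \<in> I j k" "h \<in> H"
        "y = \<phi> (j + l i + l h)"
      unfolding J_def mset_span_image[of l, OF lr_simps(1,3)] B(3) by blast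
    then have "i + h \<in> T j k"
      using I(2)[of j k] by blast
    then have "l (i + h) \<in> mset_span Q\<^sub>1" "r (i + h) \<in> mset_span Q\<^sub>2"
        "y = \<phi> (j + l (i + h))" "y = \<phi> (k + r (i + h))"
      using jk lr_span[of "i + h"] by (simp_all add: T_def add.assoc)
    then show "y \<in> Y\<^sub>1 \<inter> Y\<^sub>2"
      using jk(1,2) unfolding 1 2 by blast
  qed
  moreover have "finite J"
    using 1(1) 2(1) I(1) by (simp add: J_def)
  \<comment> \<open>A nonempty \<open>b\<close> contains a generator from one of the sides. If it is
    from the second, the grade is positive on \<open>r b\<close>, which is congruent to
    \<open>l b\<close>.\<close>
  moreover have "d (\<phi> (l b)) > 0" if b: "b \<in> B" for b
  proof -
    have eq: "\<phi> (l b) = \<phi> (r b)" and "b \<in> mset_over Q" "b \<noteq> {#}"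
      using b B(2) by (auto simp: H_def)
    then obtain s c where s: "b = {#s#} + c" "s \<in> Q"
      by (metis add_mset_add_single mset_over_simps(2) multiset_cases union_commute)
    show ?thesis
    proof (cases s)
      case (Inl g)
      then have "l {#s#} = g" "g \<in> Q\<^sub>1"
        using s by (auto simp: l_def Q_def)
      then have "d (\<phi> (l b)) = d (\<phi> g) + d (\<phi> (l c))"
        using s(1) grade_add by (simp only: lr_simps)
      then show ?thesis using 1(3) \<open>g \<in> Q\<^sub>1\<close> by simp
    next
      case (Inr g)
      then have "r {#s#} = g" "g \<in> Q\<^sub>2"
        using s by (auto simp: r_def Q_def)
      then have "d (\<phi> (r b)) = d (\<phi> g) + d (\<phi> (r c))"
        using s(1) grade_add by (simp only: lr_simps)
      then show ?thesis using 2(3) \<open>g \<in> Q\<^sub>2\<close> eq by simp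
    qed
  qed
  ultimately show ?thesis
    unfolding fg_sets_def using B(1) by (intro CollectI exI[of _ J] exI[of _ "l ` B"]) auto
qed

text \<open>Each element gets a normal form, its least representing multiset; the multisets that are not
  normal forms are upward closed because the multiset order is translation invariant.\<close>

lemma rational_set_fg_sets:
  assumes "Y \<in> fg_sets"
  shows "rational_set d Y"
proof -
  obtain J Q where J: "finite J" "finite Q" "\<forall>q\<in>Q. d (\<phi> q) > 0"
    "Y = (\<Union>j\<in>J. (\<lambda>x. \<phi> (j + x)) ` mset_span Q)"
    using assms unfolding fg_sets_def by blast
  \<comment> \<open>Numbering the generators makes the alphabet linearly ordered, hence the multiset
    order total.\<close>
  obtain f :: "nat \<Rightarrow> 'g" and n where f: "Q = f ` {i. i < n}"
    using finite_imp_nat_seg_image_inj_on[OF J(2)] by blast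
  define R where "R = {i. i < n}"
  define s where "s M = (\<Sum>i\<in>#M. f i)" for M
  have s_add [simp]: "s (M + N) = s M + s N" for M N
    by (simp add: s_def)
  define w where "w i = d (\<phi> (f i))" for i
  have grade_s: "d (\<phi> (s M)) = (\<Sum>i\<in>#M. w i)" for M
    by (induction M) (simp_all add: s_def w_def grade_add)
  have w: "w i > 0" if "i \<in> R" for i
    using J(3) that f by (auto simp: R_def w_def)
  have finR: "finite R" by (simp add: R_def)
  have span: "mset_span Q = s ` mset_over R"
  proof -
    have "mset_span (s ` ((\<lambda>i. {#i#}) ` R)) = s ` mset_span ((\<lambda>i. {#i#}) ` R)"
      by (rule mset_span_image) (simp_all add: s_def)
    moreover have "s ` ((\<lambda>i. {#i#}) ` R) = Q"
      by (simp add: f R_def s_def image_image)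
    moreover have "mset_span ((\<lambda>i. {#i#}) ` R) = mset_over R"
    proof (intro equalityI subsetI)
      fix M assume "M \<in> mset_span ((\<lambda>i. {#i#}) ` R)"
      then show "M \<in> mset_over R"
        by (rule mset_span_least) auto
    next
      fix M assume "M \<in> mset_over R"
      then show "M \<in> mset_span ((\<lambda>i. {#i#}) ` R)"
      proof (induction M)
        case empty
        then show ?case using mset_span_0 by simp
      next
        case (add i M)
        then show ?case
          using mset_span_add[OF mset_span_superset[of "{#i#}" "(\<lambda>i. {#i#}) ` R"], of M] by simp
      qed
    qed
    ultimately show ?thesis by simp
  qed
  have "rational_set d (\<Union>j\<in>J. (\<lambda>x. \<phi> (j + x)) ` mset_span Q)"
    using J(1)
  proof (induction J rule: finite_induct)
    case empty
    show ?case by (simp add: rational_set_empty)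
  next
    case (insert j J)
    define Y' where "Y' = (\<Union>j\<in>J. (\<lambda>x. \<phi> (j + x)) ` mset_span Q)"
    define g where "g M = \<phi> (j + s M)" for M
    \<comment> \<open>The multisets outside \<open>U\<close> are the normal forms of those elements
      that the new translate adds to \<open>Y'\<close>.\<close>
    define U where "U = {M \<in> mset_over R. g M \<in> Y' \<or> (\<exists>N\<in>mset_over R. N < M \<and> g N = g M)}"
    have "rational_set (\<lambda>M. \<Sum>i\<in>#M. w i) U"
    proof (rule rational_set_upward_closed[OF finR w])
      fix M K assume M: "M \<in> U" and K: "K \<in> mset_over R"
      show "M + K \<in> U"
      proof (cases "g M \<in> Y'")
        case True
        then obtain j' x where j': "j' \<in> J" "x \<in> mset_span Q" "g M = \<phi> (j' + x)"
          unfolding Y'_def by blast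
        then have "g (M + K) = \<phi> (j' + (x + s K))"
          using translate_iff[of "j + s M" "s K" "j' + x"] by (simp add: g_def add.assoc)
        moreover have "x + s K \<in> mset_span Q"
          using j'(2) K span by (intro mset_span_add) auto
        ultimately have "g (M + K) \<in> Y'"
          using j'(1) unfolding Y'_def by blast
        then show ?thesis using M K by (simp add: U_def)
      next
        case False
        then obtain N where N: "N \<in> mset_over R" "N < M" "g N = g M"
          using M by (auto simp: U_def)
        then have "N + K < M + K" "g (N + K) = g (M + K)"
          using translate_iff[of "j + s N" "s K" "j + s M"] by (simp_all add: g_def add.assoc)
        then show ?thesis
          using M K N(1) by (auto simp: U_def intro!: bexI[of _ "N + K"])
      qed
    qed (auto simp: U_def)
    moreover have "rational_set (\<lambda>M. \<Sum>i\<in>#M. w i) (mset_over R)"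
      by (rule rational_set_mset_over[OF finR w])
    ultimately have "rational_set (\<lambda>M. \<Sum>i\<in>#M. w i) (mset_over R - U)"
      by (intro rational_set_Diff) (auto simp: U_def)
    then have "rational_set d (g ` (mset_over R - U))"
    proof (rule rational_set_image_shift)
      show "inj_on g (mset_over R - U)"
      proof (rule inj_onI)
        fix M N assume "M \<in> mset_over R - U" "N \<in> mset_over R - U" "g M = g N"
        then have "\<not> M < N" "\<not> N < M"
          by (auto simp: U_def)
        then show "M = N" by simp
      qed
      show "d (g M) = (\<Sum>i\<in>#M. w i) + d (\<phi> j)" for M
        by (simp add: g_def grade_add grade_s)
    qed
    moreover have "rational_set d Y'"
      using insert.IH by (simp add: Y'_def)
    moreover have "Y' \<inter> g ` (mset_over R - U) = {}"
      by (auto simp: U_def)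
    ultimately have "rational_set d (Y' \<union> g ` (mset_over R - U))"
      by (intro rational_set_disjoint_Un)
    moreover have "(\<Union>j\<in>insert j J. (\<lambda>x. \<phi> (j + x)) ` mset_span Q) = Y' \<union> g ` (mset_over R - U)"
    proof -
      have "(\<Union>j\<in>insert j J. (\<lambda>x. \<phi> (j + x)) ` mset_span Q) =
          Y' \<union> (\<lambda>x. \<phi> (j + x)) ` mset_span Q"
        by (auto simp: Y'_def)
      then have "(\<Union>j\<in>insert j J. (\<lambda>x. \<phi> (j + x)) ` mset_span Q) = Y' \<union> g ` mset_over R"
        by (simp add: span image_image g_def)
      \<comment> \<open>Passing to smaller multisets of the same value must stop at a normal form,
        as the multiset order is well-founded.\<close>
      moreover have "g M \<in> Y' \<union> g ` (mset_over R - U)" if "M \<in> mset_over R" for M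
        using that
      proof (induction M rule: less_induct)
        case (less M)
        show ?case
        proof (cases "M \<in> U \<and> g M \<notin> Y'")
          case True
          then obtain N where "N \<in> mset_over R" "N < M" "g N = g M"
            by (auto simp: U_def)
          then show ?thesis using less.IH[of N] by simp
        qed (use less.prems in auto)
      qed
      then have "Y' \<union> g ` mset_over R = Y' \<union> g ` (mset_over R - U)"
        by blast
      ultimately show ?thesis by (rule trans)
    qed
    ultimately show ?case by (rule ssubst[rotated])
  qed
  then show ?thesis unfolding J(4) .
qed

lemma rational_set_Union_fg_sets:
  assumes "finite \<F>" "\<F> \<subseteq> fg_sets"
  shows "rational_set d (\<Union>\<F>)"
  using fg_sets_Int rational_set_fg_sets assms by (rule rational_set_Union)

end

section \<open>Edge multisets of walks\<close>

locale edge_labelled_digraph =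
  fixes src tgt :: "'e \<Rightarrow> 'v"
begin

fun walk :: "'v \<Rightarrow> 'e list \<Rightarrow> 'v \<Rightarrow> bool" where
  "walk u [] v \<longleftrightarrow> u = v"
| "walk u (e # es) v \<longleftrightarrow> src e = u \<and> walk (tgt e) es v"

lemma walk_append: "walk u (es @ es') v \<longleftrightarrow> (\<exists>x. walk u es x \<and> walk x es' v)"
  by (induction es arbitrary: u) auto

definition out_degree :: "'e multiset \<Rightarrow> 'v \<Rightarrow> nat" where
  "out_degree x v = size {#e \<in># x. src e = v#}"

definition in_degree :: "'e multiset \<Rightarrow> 'v \<Rightarrow> nat" where
  "in_degree x v = size {#e \<in># x. tgt e = v#}"

lemma degree_simps [simp]:
  "out_degree {#} v = 0" "in_degree {#} v = 0"
  "out_degree (x + y) v = out_degree x v + out_degree y v"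
  "in_degree (x + y) v = in_degree x v + in_degree y v"
  "out_degree (add_mset e x) v = (if src e = v then 1 else 0) + out_degree x v"
  "in_degree (add_mset e x) v = (if tgt e = v then 1 else 0) + in_degree x v"
  by (simp_all add: out_degree_def in_degree_def)

definition circulation :: "'e multiset \<Rightarrow> bool" where
  "circulation x \<longleftrightarrow> (\<forall>v. in_degree x v = out_degree x v)"

lemma circulation_simps:
  "circulation {#}" "circulation x \<Longrightarrow> circulation y \<Longrightarrow> circulation (x + y)"
  "circulation x \<Longrightarrow> circulation (x + y) \<Longrightarrow> circulation y"
  by (auto simp: circulation_def)

text \<open>A walk leaves each vertex as often as it enters it, up to its start and its end. The two
  corrections are added on opposite sides because subtraction of naturals truncates.\<close>

lemma walk_degree:
  "walk u es v \<Longrightarrow> out_degree (mset es) z + (if z = v then 1 else 0) =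
     in_degree (mset es) z + (if z = u then 1 else 0)"
  by (induction es arbitrary: u) (fastforce split: if_splits)+

lemma circulation_walk_diff:
  assumes "walk u es v" "walk u es' v" "mset es' = mset es + x"
  shows "circulation x"
  unfolding circulation_def
proof
  fix z
  show "in_degree x z = out_degree x z"
    using walk_degree[OF assms(1), of z] walk_degree[OF assms(2), of z] assms(3) by simp
qed

lemma circulation_closed_walk:
  assumes "walk u es u"
  shows "circulation (mset es)"
  using walk_degree[OF assms] by (simp add: circulation_def)

text \<open>A longest walk inside a circulation is closed, as otherwise an unused edge leaves its end.\<close>

lemma circulation_contains_closed_walk:
  assumes "circulation x" "e \<in># x"
  shows "\<exists>es. es \<noteq> [] \<and> walk (src e) es (src e) \<and> mset es \<subseteq># x"
proof -
  define P where "P es \<longleftrightarrow> mset es \<subseteq># x \<and> (\<exists>v. walk (src e) es v)" for es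
  have "P [e]"
    using assms(2) by (simp add: P_def)
  have "length es < Suc (size x)" if "P es" for es
    using size_mset_mono[of "mset es" x] that by (simp add: P_def)
  \<comment> \<open>A longest walk exists since no walk inside \<open>x\<close> has more than
    \<open>size x\<close> edges.\<close>
  then obtain es where es: "P es" "\<And>es'. P es' \<Longrightarrow> length es' \<le> length es"
    using ex_has_greatest_nat[of P "[e]" length "Suc (size x)"] \<open>P [e]\<close> by auto
  then have "es \<noteq> []"
    using es(2)[OF \<open>P [e]\<close>] by auto
  obtain v where v: "walk (src e) es v" "mset es \<subseteq># x"
    using es(1) by (auto simp: P_def)
  obtain y where y: "x = mset es + y"
    using v(2) by (metis mset_subset_eq_exists_conv)
  have "v = src e"
  proof (rule ccontr)
    assume "v \<noteq> src e"
    then have "out_degree (mset es) v + 1 = in_degree (mset es) v"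
      using walk_degree[OF v(1), of v] by simp
    moreover have "in_degree x v = out_degree x v"
      using assms(1) by (simp add: circulation_def)
    ultimately have "out_degree y v \<noteq> 0"
      using y by simp
    then have "{#e \<in># y. src e = v#} \<noteq> {#}"
      by (simp add: out_degree_def)
    then obtain e' where "e' \<in># {#e \<in># y. src e = v#}"
      by blast
    then have e': "e' \<in># y" "src e' = v"
      by simp_all
    have "walk (src e) (es @ [e']) (tgt e')"
      using v(1) e'(2) by (auto simp: walk_append)
    moreover have "mset (es @ [e']) \<subseteq># x"
      using e'(1) unfolding y by simp
    ultimately have "P (es @ [e'])"
      unfolding P_def by blast
    then show False
      using es(2)[of "es @ [e']"] by simp
  qed
  then show ?thesis
    using v \<open>es \<noteq> []\<close> by blast
qed

text \<open>The end is inserted because it need not be the source of any edge. Thus the vertices of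
  a walk are determined by its edge multiset and its end.\<close>

definition visited :: "'v \<Rightarrow> 'e multiset \<Rightarrow> 'v set" where
  "visited v x = insert v (src ` set_mset x)"

lemma walk_split:
  "walk u es v \<Longrightarrow> z \<in> visited v (mset es) \<Longrightarrow>
     \<exists>es\<^sub>1 es\<^sub>2. es = es\<^sub>1 @ es\<^sub>2 \<and> walk u es\<^sub>1 z \<and> walk z es\<^sub>2 v"
proof (induction es arbitrary: u)
  case Nil
  then show ?case by (auto simp: visited_def)
next
  case (Cons e es)
  show ?case
  proof (cases "z = u")
    case True
    then show ?thesis using Cons.prems(1) by (intro exI[of _ "[]"] exI[of _ "e # es"]) auto
  next
    case False
    then have "z \<in> visited v (mset es)"
      using Cons.prems by (auto simp: visited_def)
    then obtain es\<^sub>1 es\<^sub>2 where "es = es\<^sub>1 @ es\<^sub>2" "walk (tgt e) es\<^sub>1 z" "walk z es\<^sub>2 v"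
      using Cons.IH[of "tgt e"] Cons.prems(1) by auto
    then show ?thesis
      using Cons.prems(1) by (intro exI[of _ "e # es\<^sub>1"] exI[of _ es\<^sub>2]) auto
  qed
qed

text \<open>A closed walk contained in the circulation is spliced in at a visited vertex. What
  remains is a smaller circulation, and the set of visited vertices does not shrink.\<close>

lemma walk_insert_circulation:
  assumes "walk u es v" "circulation x" "src ` set_mset x \<subseteq> visited v (mset es)"
  shows "\<exists>es'. walk u es' v \<and> mset es' = mset es + x"
  using assms
proof (induction "size x" arbitrary: x es rule: less_induct)
  case less
  show ?case
  proof (cases "x = {#}")
    case True
    then show ?thesis using less.prems(1) by auto
  next
    case False
    then obtain e where e: "e \<in># x" by blast
    then obtain cs where cs: "cs \<noteq> []" "walk (src e) cs (src e)" "mset cs \<subseteq># x"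
      using circulation_contains_closed_walk less.prems(2) by blast
    obtain y where y: "x = mset cs + y"
      using cs(3) by (metis mset_subset_eq_exists_conv)
    have "src e \<in> visited v (mset es)"
      using e less.prems(3) by blast
    then obtain es\<^sub>1 es\<^sub>2 where "es = es\<^sub>1 @ es\<^sub>2" "walk u es\<^sub>1 (src e)" "walk (src e) es\<^sub>2 v"
      using walk_split less.prems(1) by blast
    then have w: "walk u (es\<^sub>1 @ cs @ es\<^sub>2) v" "mset (es\<^sub>1 @ cs @ es\<^sub>2) = mset es + mset cs"
      using cs(2) by (auto simp: walk_append)
    moreover have "circulation y"
      using circulation_simps(3)[OF circulation_closed_walk[OF cs(2)]] less.prems(2) y by simp
    moreover have "src ` set_mset y \<subseteq> visited v (mset (es\<^sub>1 @ cs @ es\<^sub>2))"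
      using less.prems(3) y unfolding w(2) by (auto simp: visited_def)
    moreover have "size y < size x"
      using cs(1) y by simp
    ultimately obtain es' where "walk u es' v" "mset es' = mset (es\<^sub>1 @ cs @ es\<^sub>2) + y"
      using less.hyps by blast
    then show ?thesis
      using w(2) y by (auto simp: add.assoc)
  qed
qed

text \<open>Fixing the exact set of visited vertices makes the same circulations insertable into all
  of these walks.\<close>

definition walk_msets :: "'e set \<Rightarrow> 'v \<Rightarrow> 'v \<Rightarrow> 'v set \<Rightarrow> 'e multiset set" where
  "walk_msets E u v V = {mset es | es. walk u es v \<and> set es \<subseteq> E \<and> visited v (mset es) = V}"

text \<open>The homogeneous part consists of the circulations with sources in \<open>V\<close>:
  inserting one yields another such walk, and comparable edge multisets of walks with the same ends
  differ by one.\<close>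

lemma walk_msets_finitely_generated:
  assumes "finite E"
  shows "\<exists>J B. finite J \<and> finite B \<and> B \<subseteq> mset_over E - {{#}} \<and>
    walk_msets E u v V = (\<Union>j\<in>J. (+) j ` mset_span B)"
proof -
  define H where "H = {x \<in> mset_over E. circulation x \<and> src ` set_mset x \<subseteq> V}"
  have "\<exists>B. finite B \<and> B \<subseteq> H - {{#}} \<and> H = mset_span B"
    using assms by (rule mset_submonoid_finitely_generated)
      (auto simp: H_def intro: circulation_simps)
  then obtain B where B: "finite B" "B \<subseteq> H - {{#}}" "H = mset_span B"
    by blast
  have "\<exists>J. finite J \<and> J \<subseteq> walk_msets E u v V \<and>
      walk_msets E u v V = (\<Union>j\<in>J. (+) j ` H)"
    using assms
  proof (rule mset_coset_finitely_generated)
    show "walk_msets E u v V \<subseteq> mset_over E"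
      by (auto simp: walk_msets_def mset_over_def)
    show "x + y \<in> walk_msets E u v V" if x: "x \<in> walk_msets E u v V" and y: "y \<in> H" for x y
    proof -
      obtain es where es: "x = mset es" "walk u es v" "set es \<subseteq> E" "visited v (mset es) = V"
        using x unfolding walk_msets_def by blast
      then obtain es' where es': "walk u es' v" "mset es' = x + y"
        using walk_insert_circulation[of u es v y] y by (auto simp: H_def)
      moreover have "set es' \<subseteq> E"
        using arg_cong[OF es'(2), of set_mset] es y by (auto simp: H_def mset_over_def)
      moreover have "visited v (mset es') = V"
        using es es' y by (auto simp: visited_def H_def)
      ultimately show ?thesis
        unfolding walk_msets_def by (intro CollectI exI[of _ es']) simp
    qed
    show "y \<in> H" if x: "x \<in> walk_msets E u v V" and y: "x + y \<in> walk_msets E u v V" for x y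
    proof -
      obtain es es' where es: "x = mset es" "walk u es v" "x + y = mset es'" "walk u es' v"
          "set es' \<subseteq> E" "visited v (mset es') = V"
        using x y unfolding walk_msets_def by blast
      then have "circulation y"
        using circulation_walk_diff[of u es v es' y] by simp
      moreover have "y \<in> mset_over E" "src ` set_mset y \<subseteq> V"
        using es(5,6) by (auto simp: mset_over_def visited_def simp flip: es(3) set_mset_mset)
      ultimately show ?thesis by (simp add: H_def)
    qed
  qed
  then obtain J where J: "finite J" "walk_msets E u v V = (\<Union>j\<in>J. (+) j ` H)"
    by blast
  have "B \<subseteq> mset_over E - {{#}}"
    using B(2) unfolding H_def by blast
  then show ?thesis
    using B(1) J unfolding B(3) by blast
qed

end

section \<open>Words in a virtually abelian group\<close>

lemma (in group) word_eval_closed: "set w \<subseteq> carrier G \<Longrightarrow> word_eval G w \<in> carrier G"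
  by (induction w) (auto simp: word_eval_def)

text \<open>Letters are kept apart from their values, so that a letter of value \<one> and
  prescribed weight can be adjoined even if the identity already is a generator.\<close>

locale weighted_letters = group G for G (structure) +
  fixes A :: "'a set" and \<Lambda> :: "'l set" and val :: "'l \<Rightarrow> 'a" and wt :: "'l \<Rightarrow> nat"
  assumes subgroup_A: "subgroup A G"
    and comm_A: "comm_group (G\<lparr>carrier := A\<rparr>)"
    and finite_index: "finite (rcosets A)"
    and finite_letters: "finite \<Lambda>"
    and val_closed: "l \<in> \<Lambda> \<Longrightarrow> val l \<in> carrier G"
    and wt_pos: "l \<in> \<Lambda> \<Longrightarrow> wt l > 0"
begin

text \<open>Representing \<open>A\<close> by \<one> makes the value of a walk from \<open>A\<close>
  free of a factor on the left; the other representatives are arbitrary.\<close>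

definition rep :: "'a set \<Rightarrow> 'a" where
  "rep c = (if c = A then \<one> else SOME x. x \<in> c)"

definition edges :: "('a set \<times> 'l) set" where
  "edges = (rcosets A) \<times> \<Lambda>"

definition edge_tgt :: "'a set \<times> 'l \<Rightarrow> 'a set" where
  "edge_tgt e = fst e #> val (snd e)"

text \<open>The Schreier generator of \<open>A\<close> that belongs to the edge.\<close>

definition edge_val :: "'a set \<times> 'l \<Rightarrow> 'a" where
  "edge_val e = rep (fst e) \<otimes> val (snd e) \<otimes> inv (rep (edge_tgt e))"

text \<open>The product is formed in \<open>G\<close> restricted to \<open>A\<close>, where
  commutativity makes it independent of any order of the edges.\<close>

definition edges_val :: "('a set \<times> 'l) multiset \<Rightarrow> 'a" where
  "edges_val x = finprod (G\<lparr>carrier := A\<rparr>)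
     (\<lambda>e. edge_val e [^]\<^bsub>G\<lparr>carrier := A\<rparr>\<^esub> count x e) edges"

definition edges_wt :: "('a set \<times> 'l) multiset \<Rightarrow> nat" where
  "edges_wt x = (\<Sum>e\<in>#x. wt (snd e))"

text \<open>Pairing the value with the weight makes the weight an invariant of the congruence, as a
  grading has to be.\<close>

definition edges_image :: "('a set \<times> 'l) multiset \<Rightarrow> 'a \<times> nat" where
  "edges_image x = (edges_val x, edges_wt x)"

sublocale abel: comm_group "G\<lparr>carrier := A\<rparr>"
  by (rule comm_A)

section \<open>Coset representatives and Schreier generators\<close>

lemma A_subset: "A \<subseteq> carrier G"
  by (rule subgroup.subset[OF subgroup_A])

lemma A_in_rcosets: "A \<in> rcosets A"
  using subgroup.subgroup_in_rcosets[OF subgroup_A is_group] .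

lemma rep_in: "c \<in> rcosets A \<Longrightarrow> rep c \<in> c"
proof (cases "c = A")
  case True
  then show ?thesis by (simp add: rep_def subgroup.one_closed[OF subgroup_A])
next
  case False
  assume "c \<in> rcosets A"
  then obtain x where "x \<in> carrier G" "c = A #> x"
    unfolding RCOSETS_def by blast
  then have "x \<in> c"
    using subgroup_A rcos_self by blast
  then show ?thesis
    using False someI[of "\<lambda>x. x \<in> c" x] by (simp add: rep_def)
qed

lemma rep_closed: "c \<in> rcosets A \<Longrightarrow> rep c \<in> carrier G"
  using rep_in subgroup.rcosets_carrier[OF subgroup_A is_group] by blast

lemma rcos_rep: "c \<in> rcosets A \<Longrightarrow> A #> rep c = c"
proof -
  assume c: "c \<in> rcosets A"
  then obtain x where "x \<in> carrier G" "c = A #> x"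
    unfolding RCOSETS_def by blast
  then show ?thesis
    using rep_in[OF c] repr_independence[OF _ _ subgroup_A] by auto
qed

lemma rcos_mult_rep:
  assumes "c \<in> rcosets A" "a \<in> A"
  shows "A #> (a \<otimes> rep c) = c"
proof -
  have "A #> (a \<otimes> rep c) = (A #> a) #> rep c"
    using assms A_subset rep_closed by (simp add: coset_mult_assoc subsetD)
  also have "A #> a = A"
    using assms(2) A_subset subgroup_A by (simp add: coset_join2 subsetD)
  finally show ?thesis
    using rcos_rep[OF assms(1)] by simp
qed

lemma finite_edges: "finite edges"
  using finite_index finite_letters by (simp add: edges_def)

lemma edge_tgt_closed: "e \<in> edges \<Longrightarrow> edge_tgt e \<in> rcosets A"
proof -
  assume e: "e \<in> edges"
  then obtain x where "x \<in> carrier G" "fst e = A #> x"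
    unfolding edges_def RCOSETS_def by force
  then have "edge_tgt e = A #> (x \<otimes> val (snd e))"
    using e val_closed A_subset by (auto simp: edge_tgt_def edges_def coset_mult_assoc)
  then show ?thesis
    using \<open>x \<in> carrier G\<close> e val_closed A_subset by (auto simp: edges_def intro!: rcosetsI)
qed

lemma edge_val_mult_rep:
  assumes "e \<in> edges"
  shows "edge_val e \<otimes> rep (edge_tgt e) = rep (fst e) \<otimes> val (snd e)"
  using assms rep_closed edge_tgt_closed[OF assms] val_closed
  by (auto simp: edge_val_def edges_def m_assoc)

text \<open>The product of the representative with the letter and the representative of the target
  lie in the same right coset of \<open>A\<close>.\<close>

lemma edge_val_closed:
  assumes "e \<in> edges"
  shows "edge_val e \<in> A"
proof -
  have mem: "rep (fst e) \<in> carrier G" "val (snd e) \<in> carrier G" "rep (edge_tgt e) \<in> carrier G"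
    using assms rep_closed edge_tgt_closed[OF assms] val_closed by (auto simp: edges_def)
  have "rep (fst e) \<in> fst e"
    using assms rep_in by (auto simp: edges_def)
  then have "rep (fst e) \<otimes> val (snd e) \<in> edge_tgt e"
    by (auto simp: edge_tgt_def r_coset_def)
  also have "edge_tgt e = A #> rep (edge_tgt e)"
    using rcos_rep edge_tgt_closed[OF assms] by simp
  finally obtain a where a: "a \<in> A" "rep (fst e) \<otimes> val (snd e) = a \<otimes> rep (edge_tgt e)"
    by (auto simp: r_coset_def)
  then have "edge_val e = a \<otimes> rep (edge_tgt e) \<otimes> inv (rep (edge_tgt e))"
    by (simp add: edge_val_def)
  also have "\<dots> = a"
    using a(1) A_subset mem by (simp add: m_assoc subsetD)
  finally show ?thesis using a(1) by simp
qed

lemma edges_val_closed: "edges_val x \<in> A"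
  unfolding edges_val_def
  using abel.finprod_closed[of "\<lambda>e. edge_val e [^]\<^bsub>G\<lparr>carrier := A\<rparr>\<^esub> count x e" edges]
    abel.nat_pow_closed edge_val_closed by (auto simp: Pi_def)

lemma edges_val_add: "edges_val (x + y) = edges_val x \<otimes> edges_val y"
proof -
  let ?B = "G\<lparr>carrier := A\<rparr>"
  have pow: "edge_val e [^]\<^bsub>?B\<^esub> n \<in> A" if "e \<in> edges" for e and n :: nat
    using abel.nat_pow_closed[of "edge_val e" n] edge_val_closed[OF that] by simp
  have "edges_val (x + y) = finprod ?B (\<lambda>e. edge_val e [^]\<^bsub>?B\<^esub> count x e \<otimes>\<^bsub>?B\<^esub>
      edge_val e [^]\<^bsub>?B\<^esub> count y e) edges"
    unfolding edges_val_def
  proof (rule abel.finprod_cong')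
    show "edge_val e [^]\<^bsub>?B\<^esub> count (x + y) e =
        edge_val e [^]\<^bsub>?B\<^esub> count x e \<otimes>\<^bsub>?B\<^esub> edge_val e [^]\<^bsub>?B\<^esub> count y e" if "e \<in> edges" for e
      using abel.nat_pow_mult[of "edge_val e"] edge_val_closed[OF that] by simp
  qed (use pow subgroup.m_closed[OF subgroup_A] in auto)
  also have "\<dots> = edges_val x \<otimes>\<^bsub>?B\<^esub> edges_val y"
    unfolding edges_val_def by (rule abel.finprod_multf) (use pow in auto)
  finally show ?thesis by simp
qed

lemma edges_val_empty: "edges_val {#} = \<one>"
  using abel.finprod_one[of edges] by (simp add: edges_val_def)

lemma edges_val_single:
  assumes "e \<in> edges"
  shows "edges_val {#e#} = edge_val e"
proof -
  let ?B = "G\<lparr>carrier := A\<rparr>"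
  have "edges_val {#e#} = finprod ?B (\<lambda>e'. if e = e' then edge_val e' else \<one>\<^bsub>?B\<^esub>) edges"
    unfolding edges_val_def
  proof (rule abel.finprod_cong')
    show "edge_val e' [^]\<^bsub>?B\<^esub> count {#e#} e' = (if e = e' then edge_val e' else \<one>\<^bsub>?B\<^esub>)"
      if "e' \<in> edges" for e'
      using edge_val_closed[OF that] A_subset by auto
  qed (use edge_val_closed subgroup.one_closed[OF subgroup_A] in auto)
  also have "\<dots> = edge_val e"
    using assms finite_edges edge_val_closed by (intro abel.finprod_singleton) auto
  finally show ?thesis .
qed

lemma edges_wt_simps [simp]:
  "edges_wt {#} = 0" "edges_wt (x + y) = edges_wt x + edges_wt y"
  "edges_wt (add_mset e x) = wt (snd e) + edges_wt x"
  by (simp_all add: edges_wt_def)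

lemma edges_wt_pos:
  assumes "x \<in> mset_over edges" "x \<noteq> {#}"
  shows "edges_wt x > 0"
proof -
  have "size x \<le> edges_wt x"
    unfolding edges_wt_def
    using assms(1) wt_pos by (intro size_le_sum_mset_weight) (auto simp: mset_over_def edges_def)
  then show ?thesis
    using assms(2) by (metis gr_zeroI le_zero_eq size_eq_0_iff_empty)
qed

sublocale digraph: edge_labelled_digraph fst edge_tgt .

sublocale graded: graded_congruence edges_image snd
proof
  show "edges_image (x + z) = edges_image (y + z) \<longleftrightarrow> edges_image x = edges_image y" for x y z
  proof -
    have "edges_val u \<in> carrier G" for u
      using edges_val_closed A_subset by blast
    then show ?thesis
      by (auto simp: edges_image_def edges_val_add)
  qed
  show "snd (edges_image (x + y)) = snd (edges_image x) + snd (edges_image y)" for x y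
    by (simp add: edges_image_def)
qed

lemma walk_end: "digraph.walk c es c' \<Longrightarrow> set es \<subseteq> edges \<Longrightarrow> c \<in> rcosets A \<Longrightarrow> c' \<in> rcosets A"
  by (induction es arbitrary: c) (auto simp: edge_tgt_closed)

text \<open>Since values of edges commute, the value of a word depends only on the multiset of edges
  of its walk through the cosets.\<close>

lemma walk_value:
  assumes "digraph.walk c es c'" "set es \<subseteq> edges" "c \<in> rcosets A"
  shows "rep c \<otimes> word_eval G (map (val \<circ> snd) es) = edges_val (mset es) \<otimes> rep c'"
  using assms
proof (induction es arbitrary: c)
  case Nil
  then show ?case
    using rep_closed by (simp add: word_eval_def edges_val_empty)
next
  case (Cons e es)
  let ?w = "word_eval G (map (val \<circ> snd) es)"
  have e: "e \<in> edges" "fst e = c" "edge_tgt e \<in> rcosets A"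
    using Cons.prems edge_tgt_closed by auto
  have w: "?w \<in> carrier G"
    using Cons.prems(2) val_closed by (intro word_eval_closed) (force simp: edges_def)
  have mem: "rep c \<in> carrier G" "val (snd e) \<in> carrier G"
      "rep (edge_tgt e) \<in> carrier G" "rep c' \<in> carrier G" "edge_val e \<in> carrier G"
      "edges_val (mset es) \<in> carrier G"
    using Cons.prems e rep_closed val_closed edge_val_closed edges_val_closed A_subset
      walk_end[OF Cons.prems]
    by (auto simp: edges_def)
  have "rep c \<otimes> word_eval G (map (val \<circ> snd) (e # es)) = (rep c \<otimes> val (snd e)) \<otimes> ?w"
    using w mem by (simp add: word_eval_def m_assoc)
  also have "\<dots> = edge_val e \<otimes> (rep (edge_tgt e) \<otimes> ?w)"
    using edge_val_mult_rep[OF e(1)] e(2) w mem by (simp add: m_assoc[symmetric])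
  also have "rep (edge_tgt e) \<otimes> ?w = edges_val (mset es) \<otimes> rep c'"
    using Cons.IH[of "edge_tgt e"] Cons.prems e(3) by (simp add: o_def)
  also have "edge_val e \<otimes> (edges_val (mset es) \<otimes> rep c') = edges_val (mset (e # es)) \<otimes> rep c'"
    using mem edges_val_add[of "{#e#}" "mset es"] edges_val_single[OF e(1)] by (simp add: m_assoc)
  finally show ?case .
qed

lemma word_walk:
  assumes "w \<in> lists \<Lambda>" "c \<in> rcosets A"
  shows "\<exists>es c'. digraph.walk c es c' \<and> set es \<subseteq> edges \<and> map snd es = w"
  using assms
proof (induction w arbitrary: c)
  case Nil
  then show ?case by (intro exI[of _ "[]"]) simp
next
  case (Cons l w)
  then have e: "(c, l) \<in> edges"
    by (simp add: edges_def)
  then obtain es c' where "digraph.walk (edge_tgt (c, l)) es c'" "set es \<subseteq> edges" "map snd es = w"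
    using Cons edge_tgt_closed by (metis lists.cases list.inject list.simps(3) Cons_in_lists_iff)
  then show ?case
    using e by (intro exI[of _ "(c, l) # es"] exI[of _ c']) simp
qed

lemma fg_sets_image:
  assumes "finite J" "finite B" "B \<subseteq> mset_over edges - {{#}}"
  shows "edges_image ` (\<Union>j\<in>J. (+) j ` mset_span B) \<in> graded.fg_sets"
  unfolding graded.fg_sets_def
proof (intro CollectI exI conjI)
  show "\<forall>q\<in>B. snd (edges_image q) > 0"
    using assms(3) edges_wt_pos by (auto simp: edges_image_def)
qed (use assms in \<open>auto simp: image_UN image_image\<close>)

text \<open>All weights of words for an element are recorded, not only the least, so different walks
  to one element need no comparison of weights.\<close>

definition attained :: "('a \<times> nat) set" where
  "attained = (\<lambda>w. (word_eval G (map val w), sum_list (map wt w))) ` lists \<Lambda>"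

text \<open>The pairs are sorted by the coset \<open>c\<close> in which the walk from
  \<open>A\<close> ends. For fixed \<open>c\<close> they arise from a finite union of sets in
  \<open>fg_sets\<close> by right multiplication with \<open>rep c\<close>, which is injective and
  preserves weights.\<close>

lemma rational_set_attained:
  assumes H: "subgroup H G"
  shows "rational_set snd (attained \<inter> (H \<times> UNIV))"
proof -
  define K where "K c = {x \<in> mset_over edges. edges_val x \<otimes> rep c \<in> H}" for c
  define W where "W c V = digraph.walk_msets edges A c V" for c V
  \<comment> \<open>The images are intersected, not the sets of multisets. This is harmless, since
    whether a multiset over \<open>edges\<close> lies in \<open>K c\<close> depends only on its
    image.\<close>
  define Y where "Y c = (\<Union>V\<in>Pow (rcosets A). edges_image ` W c V \<inter> edges_image ` K c)" for c
  define f where "f c = (\<lambda>(a, n :: nat). (a \<otimes> rep c, n))" for c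
  have val_carrier: "edges_val x \<in> carrier G" for x
    using edges_val_closed A_subset by blast
  have K_fg: "edges_image ` K c \<in> graded.fg_sets" if c: "c \<in> rcosets A" for c
  proof -
    define L where "L = {x \<in> mset_over edges. edges_val x \<in> H}"
    have left_cancel: "y \<in> H" if "x \<in> H" "x \<otimes> y \<in> H" "y \<in> carrier G" for x y
      using that H by (metis inv_solve_left' subgroup.m_closed subgroup.m_inv_closed subgroup.mem_carrier m_closed)
    have "\<exists>B. finite B \<and> B \<subseteq> L - {{#}} \<and> L = mset_span B"
      using finite_edges
    proof (rule mset_submonoid_finitely_generated)
      show "y \<in> L" if "x \<in> L" "x + y \<in> L" for x y
        using that left_cancel[of "edges_val x" "edges_val y"] val_carrier
        by (auto simp: L_def edges_val_add)
    qed (use subgroup.one_closed[OF H] subgroup.m_closed[OF H] in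
        \<open>auto simp: L_def edges_val_empty edges_val_add\<close>)
    then obtain B where B: "finite B" "B \<subseteq> L - {{#}}" "L = mset_span B"
      by blast
    \<comment> \<open>Values of edges commute with one another but not with \<open>rep c\<close>.
      Having the value of \<open>y\<close> leftmost allows the cancellation of an element of
      \<open>H\<close> on the right.\<close>
    have swap: "edges_val (x + y) \<otimes> rep c = edges_val y \<otimes> (edges_val x \<otimes> rep c)" for x y
      using val_carrier rep_closed[OF c] edges_val_add[of y x] by (simp add: m_assoc add.commute)
    have "\<exists>J. finite J \<and> J \<subseteq> K c \<and> K c = (\<Union>j\<in>J. (+) j ` L)"
      using finite_edges
    proof (rule mset_coset_finitely_generated)
      show "x + y \<in> K c" if "x \<in> K c" "y \<in> L" for x y
        using that swap subgroup.m_closed[OF H] by (auto simp: K_def L_def)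
      show "y \<in> L" if xy: "x \<in> K c" "x + y \<in> K c" for x y
      proof -
        have "edges_val y \<otimes> (edges_val x \<otimes> rep c) \<in> H" "edges_val x \<otimes> rep c \<in> H"
          using xy swap by (auto simp: K_def)
        then have "edges_val y \<otimes> (edges_val x \<otimes> rep c) \<otimes> inv (edges_val x \<otimes> rep c) \<in> H"
          using H by (simp add: subgroup.m_closed subgroup.m_inv_closed)
        then have "edges_val y \<in> H"
          using val_carrier rep_closed[OF c] by (simp add: m_assoc)
        then show ?thesis using xy by (auto simp: K_def L_def)
      qed
    qed (auto simp: K_def)
    then obtain J where J: "finite J" "K c = (\<Union>j\<in>J. (+) j ` L)"
      by blast
    have "B \<subseteq> mset_over edges - {{#}}"
      using B(2) by (auto simp: L_def)
    then show ?thesis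
      unfolding J(2) B(3) by (rule fg_sets_image[OF J(1) B(1)])
  qed
  have W_fg: "edges_image ` W c V \<in> graded.fg_sets" for c V
  proof -
    obtain J B where "finite J" "finite B" "B \<subseteq> mset_over edges - {{#}}"
        "W c V = (\<Union>j\<in>J. (+) j ` mset_span B)"
      using digraph.walk_msets_finitely_generated[OF finite_edges, of A c V] unfolding W_def by blast
    then show ?thesis using fg_sets_image[of J B] by (simp only:)
  qed
  have Y_rat: "rational_set snd (Y c)" if "c \<in> rcosets A" for c
    unfolding Y_def
    using finite_index graded.fg_sets_Int[OF W_fg K_fg[OF that]]
    by (intro graded.rational_set_Union_fg_sets) auto
  have Y_A: "a \<in> A" if "(a, n) \<in> Y c" for a n c
    using that edges_val_closed by (auto simp: Y_def edges_image_def)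
  \<comment> \<open>The pieces are disjoint because the first component of a pair lies in the coset
    \<open>c\<close>.\<close>
  have "rational_set snd (\<Union>c\<in>rcosets A. f c ` Y c)"
    using finite_index
  proof (rule rational_set_UN_disjoint)
    fix c assume c: "c \<in> rcosets A"
    show "rational_set snd (f c ` Y c)"
      using Y_rat[OF c]
    proof (rule rational_set_image_shift)
      show "inj_on (f c) (Y c)"
      proof (rule inj_onI)
        fix p q assume pq: "p \<in> Y c" "q \<in> Y c" "f c p = f c q"
        then have "fst p \<in> carrier G" "fst q \<in> carrier G"
          using Y_A[of "fst p" "snd p" c] Y_A[of "fst q" "snd q" c] A_subset by auto
        then show "p = q"
          using pq(3) rep_closed[OF c] by (simp add: f_def prod_eq_iff split: prod.splits)
      qed
      show "snd (f c y) = snd y + 0" for y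
        by (simp add: f_def split: prod.split)
    qed
  next
    have coset: "A #> fst p = c" if "c \<in> rcosets A" "p \<in> f c ` Y c" for c p
      using that Y_A rcos_mult_rep by (auto simp: f_def)
    fix c c' assume "c \<in> rcosets A" "c' \<in> rcosets A" "c \<noteq> c'"
    then show "f c ` Y c \<inter> f c' ` Y c' = {}"
      using coset by blast
  qed
  moreover have "attained \<inter> (H \<times> UNIV) = (\<Union>c\<in>rcosets A. f c ` Y c)"
  proof (intro equalityI subsetI)
    fix p assume p: "p \<in> attained \<inter> (H \<times> UNIV)"
    then obtain w where w: "w \<in> lists \<Lambda>" "p = (word_eval G (map val w), sum_list (map wt w))"
        "word_eval G (map val w) \<in> H"
      unfolding attained_def by blast
    obtain es c where es: "digraph.walk A es c" "set es \<subseteq> edges" "map snd es = w"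
      using word_walk[OF w(1) A_in_rcosets] by blast
    define x where "x = mset es"
    have c: "c \<in> rcosets A"
      using walk_end[OF es(1,2) A_in_rcosets] .
    have "word_eval G (map val w) = edges_val x \<otimes> rep c"
      using walk_value[OF es(1,2) A_in_rcosets] es(3) subgroup.mem_carrier[OF H w(3)]
      by (auto simp: x_def rep_def simp flip: map_map)
    moreover have "sum_list (map wt w) = edges_wt x"
      by (simp add: x_def edges_wt_def sum_mset_sum_list o_def flip: es(3) mset_map)
    ultimately have "p = f c (edges_image x)" "x \<in> K c"
      using w es(2) by (auto simp: f_def edges_image_def K_def x_def mset_over_def)
    moreover have "x \<in> W c (digraph.visited c x)"
      using es by (auto simp: W_def digraph.walk_msets_def x_def)
    moreover have "digraph.visited c x \<in> Pow (rcosets A)"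
      using c es(2) by (auto simp: digraph.visited_def x_def edges_def)
    ultimately show "p \<in> (\<Union>c\<in>rcosets A. f c ` Y c)"
      unfolding Y_def using c by blast
  next
    fix p assume "p \<in> (\<Union>c\<in>rcosets A. f c ` Y c)"
    then obtain c V x y where c: "c \<in> rcosets A" and x: "x \<in> W c V" and y: "y \<in> K c"
        "edges_image x = edges_image y" "p = f c (edges_image x)"
      unfolding Y_def by blast
    obtain es where es: "x = mset es" "digraph.walk A es c" "set es \<subseteq> edges"
      using x unfolding W_def digraph.walk_msets_def by blast
    define w where "w = map snd es"
    have w: "w \<in> lists \<Lambda>"
      using es(3) by (force simp: w_def edges_def)
    then have "word_eval G (map val w) \<in> carrier G"
      using val_closed by (intro word_eval_closed) auto
    then have "word_eval G (map val w) = edges_val x \<otimes> rep c"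
      using walk_value[OF es(2,3) A_in_rcosets] es(1) by (simp add: w_def rep_def)
    moreover have "sum_list (map wt w) = edges_wt x"
      by (simp add: w_def es(1) edges_wt_def sum_mset_sum_list o_def flip: mset_map)
    ultimately have "p = (word_eval G (map val w), sum_list (map wt w))"
      using y(3) by (simp add: f_def edges_image_def)
    \<comment> \<open>Membership in \<open>H\<close> is known through \<open>y\<close>; it passes to
      \<open>x\<close> because equal images have equal values.\<close>
    moreover have "word_eval G (map val w) \<in> H"
      using y \<open>word_eval G (map val w) = _\<close> by (simp add: K_def edges_image_def)
    ultimately show "p \<in> attained \<inter> (H \<times> UNIV)"
      using w unfolding attained_def by blast
  qed
  ultimately show ?thesis by simp
qed

end

section \<open>From all attained weights to the minimal weight\<close>

theorem theorem1:
  fixes G :: "('a, 'b) monoid_scheme"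
    and H S :: "'a set"
    and \<omega> :: "'a \<Rightarrow> nat"
  assumes "group G"
    and "virtually_abelian G"
    and "subgroup H G"
    and "finite_generating_set G S"
    and "\<And>s. s \<in> S \<Longrightarrow> \<omega> s \<ge> 1"
  shows "is_rational_function (relative_growth_series G H S \<omega>)"
proof -
  interpret group G by (rule assms(1))
  obtain A where A: "subgroup A G" "comm_group (G\<lparr>carrier := A\<rparr>)" "finite (rcosets\<^bsub>G\<^esub> A)"
    using assms(2) unfolding virtually_abelian_def by blast
  have S: "finite S" "S \<subseteq> carrier G" "word_eval G ` lists S = carrier G"
    using assms(4) by (auto simp: finite_generating_set_def)
  \<comment> \<open>The extra letter None has value 1 and weight 1, so that the weights of the words for an
    element are all the integers from its minimal weight on.\<close>
  define \<Lambda> where "\<Lambda> = insert None (Some ` S)"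
  define val where "val = case_option \<one>\<^bsub>G\<^esub> (\<lambda>s. s)"
  define wt where "wt = case_option 1 \<omega>"
  interpret weighted_letters G A \<Lambda> val wt
    using A S assms(5)
    by (intro weighted_letters.intro weighted_letters_axioms.intro is_group)
      (auto simp: \<Lambda>_def val_def wt_def Suc_le_eq)
  let ?d = "elem_weight G S \<omega>"
  have attained_iff: "(g, n) \<in> attained \<longleftrightarrow> ?d g \<le> n" if g: "g \<in> carrier G" for g n
  proof
    assume "(g, n) \<in> attained"
    then obtain w where w: "w \<in> lists \<Lambda>" "g = word_eval G (map val w)" "n = sum_list (map wt w)"
      unfolding attained_def by blast
    \<comment> \<open>Deleting the letters \<open>None\<close> keeps the value and cannot raise the
      weight.\<close>
    have "\<exists>u\<in>lists S. word_eval G u = word_eval G (map val w) \<and>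
        word_weight \<omega> u \<le> sum_list (map wt w)"
      using w(1)
    proof (induction w)
      case Nil
      show ?case by (intro bexI[of _ "[]"]) (auto simp: word_weight_def)
    next
      case (Cons l w)
      then obtain u where u: "u \<in> lists S" "word_eval G u = word_eval G (map val w)"
          "word_weight \<omega> u \<le> sum_list (map wt w)"
        by auto
      then have u_closed: "word_eval G u \<in> carrier G"
        using S by blast
      show ?case
      proof (cases l)
        case None
        then show ?thesis
          using u u_closed by (intro bexI[of _ u]) (auto simp: val_def wt_def word_eval_def)
      next
        case (Some s)
        then show ?thesis
          using u Cons.hyps
          by (intro bexI[of _ "s # u"]) (auto simp: val_def wt_def word_eval_def word_weight_def \<Lambda>_def)
      qed
    qed
    then obtain u where u: "u \<in> lists S" "word_eval G u = g" "word_weight \<omega> u \<le> n"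
      using w by blast
    then have "?d g \<le> word_weight \<omega> u"
      unfolding elem_weight_def by (intro Least_le) blast
    then show "?d g \<le> n"
      using u(3) by simp
  next
    assume n: "?d g \<le> n"
    have "g \<in> word_eval G ` lists S"
      using g S(3) by simp
    then obtain u\<^sub>0 where "u\<^sub>0 \<in> lists S" "word_eval G u\<^sub>0 = g"
      by blast
    then have "\<exists>w\<in>lists S. word_eval G w = g \<and> word_weight \<omega> w = word_weight \<omega> u\<^sub>0"
      by blast
    from LeastI[of "\<lambda>n. \<exists>w\<in>lists S. word_eval G w = g \<and> word_weight \<omega> w = n", OF this]
    obtain u where u: "u \<in> lists S" "word_eval G u = g" "word_weight \<omega> u = ?d g"
      unfolding elem_weight_def by blast
    \<comment> \<open>A word of minimal weight is padded with \<open>None\<close> up to weight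
      \<open>n\<close>; the hypothesis \<open>?d g \<le> n\<close> keeps the subtraction from
      truncating.\<close>
    define w where "w = replicate (n - ?d g) None @ map Some u"
    have "word_eval G (map val w) = g"
    proof -
      have "word_eval G (replicate k \<one>\<^bsub>G\<^esub> @ u) = g" for k
        using u(2) g by (induction k) (auto simp: word_eval_def)
      then show ?thesis
        by (simp add: w_def val_def o_def)
    qed
    moreover have "sum_list (map wt w) = n"
      using u(3) n by (simp add: w_def wt_def o_def sum_list_replicate word_weight_def)
    moreover have "w \<in> lists \<Lambda>"
      using u(1) by (auto simp: w_def \<Lambda>_def)
    ultimately show "(g, n) \<in> attained"
      unfolding attained_def by (intro image_eqI[of _ _ w]) auto
  qed
  \<comment> \<open>Removing from \<open>X\<close> its copy shifted by one in weight multiplies the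
    series by 1 - z and leaves, for each element, only the pair with its minimal weight.\<close>
  define X where "X = {(h, n). h \<in> H \<and> ?d h \<le> n}"
  define shift where "shift = (\<lambda>(h :: 'a, n). (h, n + 1 :: nat))"
  have "H \<subseteq> carrier G"
    by (rule subgroup.subset[OF assms(3)])
  then have "attained \<inter> (H \<times> UNIV) = X"
    using attained_iff by (auto simp: X_def)
  then have X: "rational_set snd X"
    using rational_set_attained[OF assms(3)] by simp
  moreover have "rational_set snd (shift ` X)"
    using X by (rule rational_set_image_shift[where k = 1]) (auto simp: shift_def inj_on_def)
  ultimately have "rational_set snd (X - shift ` X)"
    by (rule rational_set_Diff) (auto simp: shift_def X_def)
  moreover have "X - shift ` X = (\<lambda>h. (h, ?d h)) ` H"
  proof (intro equalityI subsetI)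
    fix p assume p: "p \<in> X - shift ` X"
    obtain h n where hn: "p = (h, n)" "h \<in> H" "?d h \<le> n"
      using p by (auto simp: X_def)
    have "n = ?d h"
    proof (rule ccontr)
      assume "n \<noteq> ?d h"
      then have "p = shift (h, n - 1)" "(h, n - 1) \<in> X"
        using hn by (auto simp: shift_def X_def)
      then show False using p by blast
    qed
    then show "p \<in> (\<lambda>h. (h, ?d h)) ` H"
      using hn by blast
  qed (auto simp: X_def shift_def)
  moreover have "grade_series snd ((\<lambda>h. (h, ?d h)) ` H) = relative_growth_series G H S \<omega>"
    using grade_series_image_shift[of "\<lambda>h. (h, ?d h)" H snd ?d 0]
    by (simp add: inj_on_def grade_series_def relative_growth_series_def)
  ultimately show ?thesis
    by (simp add: rational_set_def)
qed

end
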